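(* Let $a,b,C_1$ be real constants with $a\neq 0$, $b\neq 0$, and let $r>0$ be such that $$j_r=250\,C_1^3a^{-2}b^{-1}.$$ Then $$X=\frac{b}{250a}A_r=\frac{b}{250a}\,\frac{f(-e^{-2\pi\sqrt r})^6}{e^{-2\pi\sqrt r}f(-e^{-10\pi\sqrt r})^6}$$ is a solution of the equation $$\frac{b^2}{20a}+bX+aX^2=C_1X^{5/3}.$$
   Context: For $|q|<1$, $f(-q):=\prod_{n=1}^{\infty}(1-q^n)$. For $r>0$, $$A_r:=\frac{f(-q^2)^6}{q^2f(-q^{10})^6},\qquad q=e^{-\pi\sqrt r}.$$ The Dedekind eta function is $\eta(\tau)=e^{\pi i\tau/12}\prod_{n=1}^\infty(1-e^{2\pi i n\tau})$ for $\operatorname{Im}\tau>0$, and for $r>0$, with $\sqrt{-r}=i\sqrt r$, $$j_r:=\left[\left(\frac{\eta(\frac12\sqrt{-r})}{\eta(\sqrt{-r})}\right)^{16}+16\left(\frac{\eta(\sqrt{-r})}{\eta(\frac12\sqrt{-r})}\right)^{8}\right]^3$$ (this is the $j$-invariant at $\tau=i\sqrt r$). Fractional powers $x^{1/3}$, $x^{5/3}=(x^{1/3})^5$ of real numbers are taken with the real cube root. *)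

theory Defs
  imports "HOL-Analysis.Analysis"
begin

text \<open>
  Ramanujan's function \<open>f\<close> as a function of its actual argument, so that
  \<open>f(-q) = (1 - q) (1 - q\<^sup>2) (1 - q\<^sup>3) \<dots>\<close> is \<open>ramanujan_f (- q)\<close>.
  It is meaningful for arguments of norm less than 1.
\<close>

definition ramanujan_f :: "'a :: real_normed_field \<Rightarrow> 'a" where
  "ramanujan_f x = (\<Prod>n. 1 - (- x) ^ Suc n)"

definition A_fun :: "real \<Rightarrow> real" where
  "A_fun r = (let q = exp (- (pi * sqrt r)) in
     ramanujan_f (- (q ^ 2)) ^ 6 / (q ^ 2 * ramanujan_f (- (q ^ 10)) ^ 6))"

definition dedekind_eta :: "complex \<Rightarrow> complex" where
  "dedekind_eta \<tau> =
     exp (of_real pi * \<i> * \<tau> / 12) *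
     (\<Prod>n. 1 - exp (2 * of_real pi * \<i> * of_nat (Suc n) * \<tau>))"

text \<open>The \<open>j\<close>-invariant at \<open>\<tau> = \<i> * sqrt r\<close>.\<close>

definition j_fun :: "real \<Rightarrow> complex" where
  "j_fun r = (let \<tau> = \<i> * of_real (sqrt r) in
     ((dedekind_eta (\<tau> / 2) / dedekind_eta \<tau>) ^ 16 +
      16 * (dedekind_eta \<tau> / dedekind_eta (\<tau> / 2)) ^ 8) ^ 3)"

end

theory Submission
  imports Defs "HOL-Complex_Analysis.Complex_Analysis" "HOL-Real_Asymp.Real_Asymp"
begin

text \<open>
  With \<open>t = (\<eta>(\<tau>) / \<eta>(5\<tau>))\<^sup>6\<close> one has \<open>j = (t\<^sup>2 + 250 t + 3125)\<^sup>3 / t\<^sup>5\<close>, and at \<open>\<tau> = \<i> \<surd>r\<close> the value of \<open>t\<close>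
  is \<open>A\<^sub>r\<close>; the equation for \<open>X\<close> is the real cube root of this relation.

  The relation is the cube of \<open>E\<^sub>4(\<tau>) / (\<eta>(\<tau>) \<eta>(5\<tau>))\<^sup>4 = t + 250 + 3125 / t\<close>. The difference of both sides is
  invariant under \<open>\<tau> \<mapsto> \<tau> + 1\<close> and an elliptic element of order 2, and the Fricke involution
  \<open>\<tau> \<mapsto> -1 / (5\<tau>)\<close> exchanges it with the analogous difference for \<open>E\<^sub>4(5\<tau>)\<close>. Both vanish at infinity, as
  the first terms of the \<open>q\<close>-expansions show. These transformations suffice to move every point up to a
  fixed height, so the maximum modulus principle forces both differences to vanish. The same argument
  gives Jacobi's identity for Weber's functions, hence the modularity of \<open>E\<^sub>4\<close>.

  The inversion formula for \<open>\<eta>\<close> comes from the Jacobi theta product: its transform under \<open>\<tau> \<mapsto> -1 / \<tau>\<close> has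
  the same quasi-periods and the same simple zeros, so the quotient is constant by Liouville's theorem.
\<close>

section \<open>Infinite \<open>q\<close>-products\<close>

text \<open>The infinite q-Pochhammer symbol (w; p). It is generic in the field because the real
  products in \<open>A_fun\<close> are compared with the complex products in eta.\<close>

definition qpoch :: "'a \<Rightarrow> 'a \<Rightarrow> 'a :: {real_normed_field, banach}" where
  "qpoch w p = (\<Prod>n. 1 - w * p ^ n)"

definition euler_phi :: "'a \<Rightarrow> 'a :: {real_normed_field, banach}" where
  "euler_phi p = qpoch p p"

lemma summable_qpoch:
  fixes p :: "'a :: {real_normed_field, banach}"
  assumes "norm p < 1"
  shows "summable (\<lambda>n. norm (w * p ^ n))"
  using assms by (simp add: norm_mult norm_power summable_geometric summable_mult)

lemma convergent_qpoch:
  fixes p :: "'a :: {real_normed_field, banach}"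
  assumes "norm p < 1"
  shows "convergent_prod (\<lambda>n. 1 - w * p ^ n)"
proof (rule abs_convergent_prod_imp_convergent_prod)
  show "abs_convergent_prod (\<lambda>n. 1 - w * p ^ n)"
    unfolding abs_convergent_prod_conv_summable using summable_qpoch[OF assms] by simp
qed

lemma has_prod_qpoch:
  fixes p :: "'a :: {real_normed_field, banach}"
  assumes "norm p < 1"
  shows "(\<lambda>n. 1 - w * p ^ n) has_prod qpoch w p"
  using convergent_qpoch[OF assms] unfolding qpoch_def by (rule convergent_prod_has_prod)

lemma qpoch_LIMSEQ:
  fixes p :: "'a :: {real_normed_field, banach}"
  assumes "norm p < 1"
  shows "(\<lambda>n. \<Prod>k<n. 1 - w * p ^ k) \<longlonglongrightarrow> qpoch w p"
  using convergent_prod_LIMSEQ[OF convergent_qpoch[OF assms]]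
  unfolding qpoch_def LIMSEQ_lessThan_iff_atMost by simp

lemma qpoch_eq_0_iff:
  fixes p :: "'a :: {real_normed_field, banach}"
  assumes "norm p < 1"
  shows "qpoch w p = 0 \<longleftrightarrow> (\<exists>n. w * p ^ n = 1)"
  using has_prod_eq_0_iff[OF has_prod_qpoch[OF assms, of w]] by force

lemma qpoch_rec:
  fixes p :: "'a :: {real_normed_field, banach}"
  assumes "norm p < 1"
  shows "qpoch w p = (1 - w) * qpoch (w * p) p"
proof (rule LIMSEQ_unique)
  show "(\<lambda>n. \<Prod>k<Suc n. 1 - w * p ^ k) \<longlonglongrightarrow> qpoch w p"
    using qpoch_LIMSEQ[OF assms, of w] by (rule LIMSEQ_Suc)
  have "(\<lambda>n. (1 - w) * (\<Prod>k<n. 1 - w * p * p ^ k)) \<longlonglongrightarrow> (1 - w) * qpoch (w * p) p"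
    by (intro tendsto_intros qpoch_LIMSEQ assms)
  then show "(\<lambda>n. \<Prod>k<Suc n. 1 - w * p ^ k) \<longlonglongrightarrow> (1 - w) * qpoch (w * p) p"
    by (simp add: prod.lessThan_Suc_shift mult.assoc del: prod.lessThan_Suc)
qed

lemma norm_square_less_1:
  fixes p :: "'a :: real_normed_field"
  assumes "norm p < 1"
  shows "norm (p\<^sup>2) < 1"
  using assms by (simp add: norm_power power_less_one_iff)

lemma qpoch_even_odd:
  fixes p :: "'a :: {real_normed_field, banach}"
  assumes "norm p < 1"
  shows "qpoch w p = qpoch w (p\<^sup>2) * qpoch (w * p) (p\<^sup>2)"
proof (rule LIMSEQ_unique)
  note p2 = norm_square_less_1[OF assms]
  \<comment> \<open>Partial products of even length form a subsequence, and these split exactly by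
    the parity of the exponent.\<close>
  have "(\<lambda>n. \<Prod>k<n + n. 1 - w * p ^ k) \<longlonglongrightarrow> qpoch w p"
    by (rule filterlim_compose[OF qpoch_LIMSEQ[OF assms]], rule filterlim_at_top_mono[OF filterlim_ident]) simp
  moreover have "(\<Prod>k<n + n. 1 - w * p ^ k) =
      (\<Prod>k<n. 1 - w * (p\<^sup>2) ^ k) * (\<Prod>k<n. 1 - w * p * (p\<^sup>2) ^ k)" for n
    by (induction n) (simp_all add: power_mult[symmetric] mult_2 mult_2_right power_add mult_ac)
  ultimately show "(\<lambda>n. (\<Prod>k<n. 1 - w * (p\<^sup>2) ^ k) * (\<Prod>k<n. 1 - w * p * (p\<^sup>2) ^ k)) \<longlonglongrightarrow> qpoch w p"
    by simp
  show "(\<lambda>n. (\<Prod>k<n. 1 - w * (p\<^sup>2) ^ k) * (\<Prod>k<n. 1 - w * p * (p\<^sup>2) ^ k))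
      \<longlonglongrightarrow> qpoch w (p\<^sup>2) * qpoch (w * p) (p\<^sup>2)"
    by (intro tendsto_mult qpoch_LIMSEQ p2)
qed

lemma qpoch_mult_uminus:
  fixes p :: "'a :: {real_normed_field, banach}"
  assumes "norm p < 1"
  shows "qpoch w p * qpoch (- w) p = qpoch (w\<^sup>2) (p\<^sup>2)"
proof (rule LIMSEQ_unique)
  show "(\<lambda>n. (\<Prod>k<n. 1 - w * p ^ k) * (\<Prod>k<n. 1 - (- w) * p ^ k)) \<longlonglongrightarrow> qpoch w p * qpoch (- w) p"
    by (intro tendsto_mult qpoch_LIMSEQ assms)
  have "(\<Prod>k<n. 1 - w * p ^ k) * (\<Prod>k<n. 1 - (- w) * p ^ k) = (\<Prod>k<n. 1 - w\<^sup>2 * (p\<^sup>2) ^ k)" for n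
    unfolding prod.distrib[symmetric]
    by (intro prod.cong) (auto simp: algebra_simps power2_eq_square power_mult_distrib)
  then show "(\<lambda>n. (\<Prod>k<n. 1 - w * p ^ k) * (\<Prod>k<n. 1 - (- w) * p ^ k)) \<longlonglongrightarrow> qpoch (w\<^sup>2) (p\<^sup>2)"
    using qpoch_LIMSEQ[OF norm_square_less_1[OF assms], of "w\<^sup>2"] by simp
qed

lemma euler_phi_nonzero:
  fixes p :: "'a :: {real_normed_field, banach}"
  assumes "norm p < 1"
  shows "euler_phi p \<noteq> 0"
proof
  assume "euler_phi p = 0"
  then obtain n where "p * p ^ n = 1"
    unfolding euler_phi_def qpoch_eq_0_iff[OF assms] by blast
  then have "norm p ^ Suc n = 1"
    by (metis norm_one norm_power power_Suc)
  then show False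
    using assms by (metis norm_ge_zero power_eq_1_iff zero_less_Suc less_irrefl abs_of_nonneg power_less_one_iff nat.distinct(1))
qed

text \<open>The product form of Euler's theorem that partitions into odd parts and into distinct
  parts are equinumerous. It trivialises the product of Weber's three functions.\<close>

lemma qpoch_weber_product:
  fixes p :: "'a :: {real_normed_field, banach}"
  assumes "norm p < 1"
  shows "qpoch p (p\<^sup>2) * qpoch (- p) p = 1"
proof -
  have "euler_phi p * qpoch (- p) p = euler_phi (p\<^sup>2)"
    unfolding euler_phi_def by (rule qpoch_mult_uminus[OF assms])
  moreover have "euler_phi p = qpoch p (p\<^sup>2) * euler_phi (p\<^sup>2)"
    using qpoch_even_odd[OF assms, of p] by (simp add: euler_phi_def power2_eq_square)
  ultimately have "(qpoch p (p\<^sup>2) * qpoch (- p) p) * euler_phi (p\<^sup>2) = 1 * euler_phi (p\<^sup>2)"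
    by (simp add: mult_ac)
  then show ?thesis
    using euler_phi_nonzero[OF norm_square_less_1[OF assms]] mult_cancel_right by blast
qed

text \<open>Replacing p by -p changes only the factors of odd exponent, and
  \<open>qpoch_mult_uminus\<close> evaluates their product with the original ones. This gives access
  to eta at \<open>(\<tau> + 1) / 2\<close>.\<close>

lemma euler_phi_uminus:
  fixes p :: "'a :: {real_normed_field, banach}"
  assumes "norm p < 1"
  shows "euler_phi (- p) * euler_phi p * euler_phi (p ^ 4) = euler_phi (p\<^sup>2) ^ 3"
proof -
  have split: "euler_phi u = qpoch u (u\<^sup>2) * euler_phi (u\<^sup>2)" if "norm u < 1" for u :: 'a
    using qpoch_even_odd[OF that, of u] by (simp add: euler_phi_def power2_eq_square)
  note p2 = norm_square_less_1[OF assms]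
  have "euler_phi (- p) * euler_phi p * euler_phi (p ^ 4) =
     (qpoch p (p\<^sup>2) * qpoch (- p) (p\<^sup>2)) * euler_phi (p\<^sup>2) ^ 2 * euler_phi (p ^ 4)"
    using split[OF assms] split[of "- p"] assms by (simp add: power2_eq_square mult_ac)
  also have "qpoch p (p\<^sup>2) * qpoch (- p) (p\<^sup>2) = qpoch (p\<^sup>2) ((p\<^sup>2)\<^sup>2)"
    by (rule qpoch_mult_uminus[OF p2])
  also have "\<dots> * euler_phi (p\<^sup>2) ^ 2 * euler_phi (p ^ 4) = euler_phi (p\<^sup>2) ^ 3"
    using split[OF p2] by (simp add: power2_eq_square power3_eq_cube power4_eq_xxxx mult_ac)
  finally show ?thesis .
qed

lemma euler_phi_of_real:
  assumes "\<bar>x\<bar> < 1"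
  shows "euler_phi (complex_of_real x) = of_real (euler_phi x)"
proof -
  have "(\<lambda>n. complex_of_real (1 - x * x ^ n)) has_prod of_real (euler_phi x)"
    unfolding has_prod_of_real_iff using has_prod_qpoch[of x x] assms by (simp add: euler_phi_def)
  moreover have "(\<lambda>n. 1 - complex_of_real x * of_real x ^ n) has_prod euler_phi (complex_of_real x)"
    using has_prod_qpoch[of "complex_of_real x" "of_real x"] assms by (simp add: euler_phi_def)
  ultimately show ?thesis
    by (simp add: has_prod_unique2)
qed

section \<open>Holomorphy and size of infinite products\<close>

lemma holomorphic_on_prodinf_summable:
  fixes f :: "nat \<Rightarrow> complex \<Rightarrow> complex"
  assumes "open S" and hol: "\<And>n. f n holomorphic_on S"
    and bound: "\<And>x. x \<in> S \<Longrightarrow> \<exists>d>0. cball x d \<subseteq> S \<and>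
      (\<exists>M. summable M \<and> (\<forall>n. \<forall>z\<in>cball x d. norm (f n z - 1) \<le> M n))"
  shows "(\<lambda>z. \<Prod>n. f n z) holomorphic_on S"
proof (rule holomorphic_uniform_sequence[where f = "\<lambda>N z. \<Prod>n<N. f n z"])
  fix x assume "x \<in> S"
  then obtain d M where d: "d > 0" "cball x d \<subseteq> S" and M: "summable M"
    and le: "\<And>n z. z \<in> cball x d \<Longrightarrow> norm (f n z - 1) \<le> M n"
    using bound by metis
  have conv: "convergent_prod (\<lambda>n. f n z)" if "z \<in> cball x d" for z
    by (intro abs_convergent_prod_imp_convergent_prod)
       (auto simp: abs_convergent_prod_conv_summable intro!: summable_comparison_test'[OF M] le that)
  \<comment> \<open>By the Weierstrass M-test the partial products converge uniformly on the disc; a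
    locally uniform limit of holomorphic functions is holomorphic.\<close>
  have "uniformly_convergent_on (cball x d) (\<lambda>N z. \<Prod>n<N. f n z)"
  proof (rule uniformly_convergent_on_prod')
    show "continuous_on (cball x d) (f n)" for n
      using holomorphic_on_imp_continuous_on[OF hol] continuous_on_subset d(2) by blast
    show "uniformly_convergent_on (cball x d) (\<lambda>N z. \<Sum>n<N. norm (f n z - 1))"
      by (rule Weierstrass_m_test'[OF _ M]) (simp add: le)
  qed simp
  then obtain l where l: "uniform_limit (cball x d) (\<lambda>N z. \<Prod>n<N. f n z) l sequentially"
    by (auto simp: uniformly_convergent_on_def)
  moreover have "l z = (\<Prod>n. f n z)" if "z \<in> cball x d" for z
  proof (rule LIMSEQ_unique[OF tendsto_uniform_limitI[OF l that]])
    show "(\<lambda>N. \<Prod>n<N. f n z) \<longlonglongrightarrow> (\<Prod>n. f n z)"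
      using convergent_prod_LIMSEQ[OF conv[OF that]] unfolding LIMSEQ_lessThan_iff_atMost .
  qed
  ultimately have "uniform_limit (cball x d) (\<lambda>N z. \<Prod>n<N. f n z) (\<lambda>z. \<Prod>n. f n z) sequentially"
    using uniform_limit_cong'[of "cball x d" "\<lambda>N z. \<Prod>n<N. f n z" "\<lambda>N z. \<Prod>n<N. f n z" l "\<lambda>z. \<Prod>n. f n z"]
    by blast
  then show "\<exists>d>0. cball x d \<subseteq> S \<and>
      uniform_limit (cball x d) (\<lambda>N z. \<Prod>n<N. f n z) (\<lambda>z. \<Prod>n. f n z) sequentially"
    using d by blast
qed (use assms in \<open>auto intro!: holomorphic_intros\<close>)

lemma holomorphic_qpoch:
  assumes "norm p < 1"
  shows "(\<lambda>w. qpoch w p) holomorphic_on (UNIV :: complex set)"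
  unfolding qpoch_def
proof (rule holomorphic_on_prodinf_summable)
  fix x :: complex
  have "norm (1 - z * p ^ n - 1) \<le> (norm x + 1) * norm p ^ n" if "z \<in> cball x 1" for z n
  proof -
    have "norm z \<le> norm x + 1"
      using that norm_triangle_ineq2[of z x] by (simp add: dist_norm norm_minus_commute)
    then show ?thesis
      by (simp add: norm_mult norm_power mult_right_mono)
  qed
  moreover have "summable (\<lambda>n. (norm x + 1) * norm p ^ n)"
    using assms by (intro summable_mult summable_geometric) simp
  ultimately show "\<exists>d>0. cball x d \<subseteq> UNIV \<and>
      (\<exists>M. summable M \<and> (\<forall>n. \<forall>z\<in>cball x d. norm (1 - z * p ^ n - 1) \<le> M n))"
    by (intro exI[of _ 1] conjI exI[of _ "\<lambda>n. (norm x + 1) * norm p ^ n"]) auto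
qed (auto intro!: holomorphic_intros)

lemma holomorphic_euler_phi: "euler_phi holomorphic_on ball (0 :: complex) 1"
proof -
  have "(\<lambda>z. \<Prod>n. 1 - z * z ^ n) holomorphic_on ball (0 :: complex) 1"
  proof (rule holomorphic_on_prodinf_summable)
    fix x :: complex assume "x \<in> ball 0 1"
    then have x: "norm x < 1" by simp
    \<comment> \<open>Half the distance to the unit circle: the disc of radius \<open>d\<close>
      around \<open>x\<close> stays within a circle of radius below 1, which supplies a geometric
      majorant.\<close>
    define d where "d = (1 - norm x) / 2"
    have d: "d > 0" "norm x + d < 1"
      using x by (auto simp: d_def field_simps)
    have le: "norm z \<le> norm x + d" if "z \<in> cball x d" for z
      using that norm_triangle_ineq2[of z x] by (simp add: dist_norm norm_minus_commute)
    have "norm (1 - z * z ^ n - 1) \<le> (norm x + d) ^ Suc n" if "z \<in> cball x d" for z n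
      using power_mono[OF le[OF that], of "Suc n"] by (simp add: norm_mult norm_power)
    moreover have "summable (\<lambda>n. (norm x + d) ^ Suc n)"
      unfolding summable_Suc_iff using d(1) d(2) by (intro summable_geometric) simp
    moreover have "cball x d \<subseteq> ball 0 1"
      using le d(2) by force
    ultimately show "\<exists>d>0. cball x d \<subseteq> ball 0 1 \<and>
        (\<exists>M. summable M \<and> (\<forall>n. \<forall>z\<in>cball x d. norm (1 - z * z ^ n - 1) \<le> M n))"
      using d(1) by blast
  qed (auto intro!: holomorphic_intros)
  then show ?thesis
    by (simp add: euler_phi_def[abs_def] qpoch_def)
qed

text \<open>Passing to absolute values bounds the product by the exponential of a geometric series.
  With \<open>w = h ^ 3\<close> and \<open>p = h\<close> this shows that the tail of Euler's product
  does not reach order \<open>h\<^sup>2\<close>.\<close>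

lemma norm_qpoch_minus_1_le:
  fixes p :: "'a :: {real_normed_field, banach}"
  assumes "norm p < 1"
  shows "norm (qpoch w p - 1) \<le> exp (norm w / (1 - norm p)) - 1"
proof (rule LIMSEQ_le_const2)
  show "(\<lambda>n. norm ((\<Prod>k<n. 1 - w * p ^ k) - 1)) \<longlonglongrightarrow> norm (qpoch w p - 1)"
    by (intro tendsto_intros qpoch_LIMSEQ assms)
  have "norm ((\<Prod>k<n. 1 - w * p ^ k) - 1) \<le> exp (norm w / (1 - norm p)) - 1" for n
  proof -
    have "norm ((\<Prod>k<n. 1 + - (w * p ^ k)) - 1) \<le> (\<Prod>k<n. 1 + norm (- (w * p ^ k))) - 1"
      by (rule norm_prod_minus1_le_prod_minus1)
    also have "(\<Prod>k<n. 1 + norm (- (w * p ^ k))) \<le> exp (\<Sum>k<n. norm (- (w * p ^ k)))"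
      by (rule prod_le_exp_sum) auto
    also have "(\<Sum>k<n. norm (- (w * p ^ k))) \<le> (\<Sum>k. norm (w * p ^ k))"
      unfolding norm_minus_cancel by (rule sum_le_suminf[OF summable_qpoch[OF assms]]) auto
    also have "(\<Sum>k. norm (w * p ^ k)) = norm w / (1 - norm p)"
      using assms by (simp add: norm_mult norm_power suminf_mult suminf_geometric summable_geometric)
    finally show ?thesis by simp
  qed
  then show "\<exists>N. \<forall>n\<ge>N. norm ((\<Prod>k<n. 1 - w * p ^ k) - 1) \<le> exp (norm w / (1 - norm p)) - 1"
    by blast
qed

section \<open>The Jacobi theta product and the inversion of the eta function\<close>

definition ee :: "complex \<Rightarrow> complex" where
  "ee z = exp (2 * of_real pi * \<i> * z)"

lemma ee_add: "ee (x + y) = ee x * ee y"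
  by (simp add: ee_def distrib_left exp_add)

lemma ee_diff: "ee (x - y) = ee x / ee y"
  by (simp add: ee_def right_diff_distrib exp_diff)

lemma ee_minus: "ee (- x) = 1 / ee x"
  by (simp add: ee_def exp_minus field_simps)

lemma ee_nonzero [simp]: "ee x \<noteq> 0"
  by (simp add: ee_def)

lemma ee_0 [simp]: "ee 0 = 1"
  by (simp add: ee_def)

lemma ee_power: "ee x ^ n = ee (of_nat n * x)"
  by (simp add: ee_def exp_of_nat_mult[symmetric] mult_ac)

lemma ee_1 [simp]: "ee 1 = 1"
  by (simp add: ee_def)

lemma ee_half: "ee (1 / 2) = -1"
  by (simp add: ee_def)

lemma ee_quarter: "ee (1 / 4) = \<i>"
proof -
  have "2 * of_real pi * \<i> * (1 / 4) = \<i> * complex_of_real (pi / 2)"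
    by simp
  then show ?thesis
    unfolding ee_def by (simp only: cis_conv_exp[symmetric] cis_pi_half)
qed

lemma ee_eq_1D:
  assumes "ee x = 1"
  obtains k :: int where "x = of_int k"
proof -
  obtain n :: int where "Re (2 * of_real pi * \<i> * x) = 0" "Im (2 * of_real pi * \<i> * x) = of_int (2 * n) * pi"
    using assms unfolding ee_def exp_eq_1 by blast
  then have "x = of_int n"
    by (auto simp: complex_eq_iff)
  then show ?thesis by (rule that)
qed

lemma norm_ee: "norm (ee x) = exp (- (2 * pi * Im x))"
  by (simp add: ee_def)

lemma norm_ee_less_1 [simp]: "Im x > 0 \<Longrightarrow> norm (ee x) < 1"
  by (simp add: norm_ee)

lemma holomorphic_ee [holomorphic_intros]:
  "f holomorphic_on A \<Longrightarrow> (\<lambda>z. ee (f z)) holomorphic_on A"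
  unfolding ee_def by (intro holomorphic_intros)

lemma has_field_derivative_ee [derivative_intros]:
  "(f has_field_derivative f') (at z within A) \<Longrightarrow>
   ((\<lambda>z. ee (f z)) has_field_derivative 2 * of_real pi * \<i> * ee (f z) * f') (at z within A)"
  unfolding ee_def by (auto intro!: derivative_eq_intros)

text \<open>Jacobi's theta_1 without a factor that depends on \<open>\<tau>\<close> only, scaled to
  the lattice spanned by 1 and \<open>\<tau>\<close>. The products start at exponent 1 because the
  first factor carries the integer zeros.\<close>

definition theta :: "complex \<Rightarrow> complex \<Rightarrow> complex" where
  "theta \<tau> z = (ee (z / 2) - ee (- z / 2)) * qpoch (ee (\<tau> + z)) (ee \<tau>) * qpoch (ee (\<tau> - z)) (ee \<tau>)"

lemma holomorphic_theta:
  assumes "Im \<tau> > 0" "f holomorphic_on A"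
  shows "(\<lambda>z. theta \<tau> (f z)) holomorphic_on A"
proof -
  have q: "(\<lambda>z. qpoch (g z) (ee \<tau>)) holomorphic_on A" if "g holomorphic_on A" for g
    using holomorphic_on_compose[OF that holomorphic_on_subset[OF holomorphic_qpoch]] assms(1)
    by (simp add: o_def)
  show ?thesis
    unfolding theta_def by (intro holomorphic_intros q assms(2)) auto
qed

lemma theta_uminus: "theta \<tau> (- z) = - theta \<tau> z"
  by (simp add: theta_def algebra_simps)

lemma theta_0: "theta \<tau> 0 = 0"
  by (simp add: theta_def)

lemma theta_add_1: "theta \<tau> (z + 1) = - theta \<tau> z"
proof -
  have "ee ((z + 1) / 2) = - ee (z / 2)" "ee (- (z + 1) / 2) = - ee (- z / 2)"
    using ee_half by (simp_all add: add_divide_distrib diff_divide_distrib ee_add ee_diff)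
  moreover have "ee (\<tau> + (z + 1)) = ee (\<tau> + z)" "ee (\<tau> - (z + 1)) = ee (\<tau> - z)"
    by (simp_all add: ee_add ee_diff)
  ultimately show ?thesis
    unfolding theta_def by (simp only: minus_diff_minus mult_minus_left)
qed

text \<open>The translation moves one factor from one product to the other, so only elementary
  factors remain. The square roots \<open>s\<close> and \<open>r\<close> keep all exponents
  integral.\<close>

lemma theta_add_tau:
  assumes "Im \<tau> > 0"
  shows "theta \<tau> (z + \<tau>) = - ee (- \<tau> / 2 - z) * theta \<tau> z"
proof -
  define s r where "s = ee (z / 2)" and "r = ee (\<tau> / 2)"
  have sr: "s \<noteq> 0" "r \<noteq> 0" by (simp_all add: s_def r_def)
  have z: "ee z = s\<^sup>2" "ee \<tau> = r\<^sup>2"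
    by (simp_all add: s_def r_def ee_power)
  note rec = qpoch_rec[OF norm_ee_less_1[OF assms]]
  have 1: "qpoch (ee (\<tau> + z)) (ee \<tau>) = (1 - r\<^sup>2 * s\<^sup>2) * qpoch (ee (\<tau> + (z + \<tau>))) (ee \<tau>)"
  proof -
    have a: "ee (\<tau> + (z + \<tau>)) = (r\<^sup>2 * s\<^sup>2) * ee \<tau>"
      unfolding ee_add z by (simp add: mult_ac)
    have b: "ee (\<tau> + z) = r\<^sup>2 * s\<^sup>2"
      unfolding ee_add z by (rule refl)
    show ?thesis
      unfolding a b by (rule rec)
  qed
  have 2: "qpoch (ee (\<tau> - (z + \<tau>))) (ee \<tau>) = (1 - 1 / s\<^sup>2) * qpoch (ee (\<tau> - z)) (ee \<tau>)"
    by (subst rec) (simp add: ee_add ee_diff ee_minus z mult_ac)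
  have sr': "ee ((z + \<tau>) / 2) = s * r"
    unfolding add_divide_distrib ee_add s_def r_def by (rule refl)
  have 3: "ee ((z + \<tau>) / 2) = s * r" "ee (- (z + \<tau>) / 2) = 1 / (s * r)" "ee (- z / 2) = 1 / s"
    unfolding minus_divide_left[symmetric] ee_minus sr' by (simp_all add: s_def)
  have 4: "ee (- \<tau> / 2 - z) = 1 / (r * s\<^sup>2)"
    by (simp add: ee_diff ee_minus z r_def[symmetric])
  have "theta \<tau> (z + \<tau>) =
     (s * r - 1 / (s * r)) * (1 - 1 / s\<^sup>2) * qpoch (ee (\<tau> + (z + \<tau>))) (ee \<tau>) * qpoch (ee (\<tau> - z)) (ee \<tau>)"
    unfolding theta_def 2 3 by simp
  also have "(s * r - 1 / (s * r)) * (1 - 1 / s\<^sup>2) = - (1 / (r * s\<^sup>2)) * (s - 1 / s) * (1 - r\<^sup>2 * s\<^sup>2)"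
    using sr by (simp add: field_simps power2_eq_square)
  also have "\<dots> * qpoch (ee (\<tau> + (z + \<tau>))) (ee \<tau>) * qpoch (ee (\<tau> - z)) (ee \<tau>) =
     - ee (- \<tau> / 2 - z) * theta \<tau> z"
    unfolding theta_def 1 3 4 s_def[symmetric] by simp
  finally show ?thesis .
qed

lemma theta_diff_tau:
  assumes "Im \<tau> > 0"
  shows "theta \<tau> (z - \<tau>) = - ee (z - \<tau> / 2) * theta \<tau> z"
proof -
  define A B T where "A = ee (- \<tau> / 2 - (z - \<tau>))" and "B = ee (z - \<tau> / 2)" and "T = theta \<tau> (z - \<tau>)"
  have "A * B = ee 0"
    unfolding A_def B_def ee_add[symmetric] by (rule arg_cong[of _ _ ee]) (simp add: field_simps)
  moreover have "theta \<tau> z = - A * T"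
    using theta_add_tau[OF assms, of "z - \<tau>"] unfolding diff_add_cancel A_def T_def .
  ultimately have "T = - B * theta \<tau> z"
    by (simp add: mult.assoc[symmetric] mult.commute[of B])
  then show ?thesis
    by (simp only: T_def B_def)
qed

lemma theta_eq_0D:
  assumes "Im \<tau> > 0" "theta \<tau> z = 0"
  obtains m n :: int where "z = of_int m + of_int n * \<tau>"
proof -
  note iff = qpoch_eq_0_iff[OF norm_ee_less_1[OF assms(1)]]
  consider "ee (z / 2) = ee (- z / 2)"
    | n where "ee (\<tau> + z) * ee \<tau> ^ n = 1" | n where "ee (\<tau> - z) * ee \<tau> ^ n = 1"
    using assms(2) unfolding theta_def by (auto simp: iff)
  then show thesis
  proof cases
    case 1
    then have "ee (z / 2 + z / 2) = ee (z / 2 + - z / 2)"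
      unfolding ee_add by simp
    then have "ee z = 1"
      by simp
    then obtain m where "z = of_int m"
      by (auto elim: ee_eq_1D)
    then show thesis
      using that[of m 0] by simp
  next
    case 2
    then have "ee (\<tau> + z + of_nat n * \<tau>) = 1"
      by (simp add: ee_add ee_power)
    then obtain m where "\<tau> + z + of_nat n * \<tau> = of_int m"
      by (rule ee_eq_1D)
    \<comment> \<open>The product starts at exponent 1, so the coefficient of \<open>\<tau>\<close>
      is -(n + 1); the next case is its mirror image.\<close>
    then show thesis
      using that[of m "- int n - 1"] by (simp add: algebra_simps)
  next
    case 3
    then have "ee (\<tau> - z + of_nat n * \<tau>) = 1"
      by (simp add: ee_add ee_power)
    then obtain m where "\<tau> - z + of_nat n * \<tau> = of_int m"
      by (rule ee_eq_1D)
    then show thesis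
      using that[of "- m" "int n + 1"] by (simp add: algebra_simps)
  qed
qed

lemma has_field_derivative_theta_0:
  assumes "Im \<tau> > 0"
  shows "(theta \<tau> has_field_derivative 2 * of_real pi * \<i> * euler_phi (ee \<tau>) ^ 2) (at 0)"
proof -
  let ?Q = "\<lambda>z. qpoch (ee (\<tau> + z)) (ee \<tau>) * qpoch (ee (\<tau> - z)) (ee \<tau>)"
  have q: "(\<lambda>z. qpoch (g z) (ee \<tau>)) holomorphic_on UNIV" if "g holomorphic_on UNIV" for g
    using holomorphic_on_compose[OF that holomorphic_on_subset[OF holomorphic_qpoch]] assms
    by (simp add: o_def)
  have "?Q holomorphic_on UNIV"
    by (intro holomorphic_intros q)
  then have "(?Q has_field_derivative deriv ?Q 0) (at 0)"
    by (rule holomorphic_derivI) auto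
  moreover have "((\<lambda>z. ee (z / 2) - ee (- z / 2)) has_field_derivative 2 * of_real pi * \<i>) (at 0)"
    by (auto intro!: derivative_eq_intros)
  \<comment> \<open>The first factor vanishes at 0, so only its derivative survives, multiplied by
    \<open>?Q 0\<close>.\<close>
  ultimately have "((\<lambda>z. (ee (z / 2) - ee (- z / 2)) * ?Q z) has_field_derivative
      2 * of_real pi * \<i> * ?Q 0 + deriv ?Q 0 * (ee (0 / 2) - ee (- 0 / 2))) (at 0)"
    by (intro DERIV_mult)
  then show ?thesis
    by (simp add: theta_def[abs_def] euler_phi_def power2_eq_square mult.assoc)
qed

text \<open>The values at the half periods are squares of Weber's functions up to elementary factors.\<close>

lemma theta_half:
  assumes "Im \<tau> > 0"
  shows "theta \<tau> (1 / 2) = 2 * \<i> * qpoch (- ee \<tau>) (ee \<tau>) ^ 2"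
    and "theta \<tau> (\<tau> / 2) = - ee (- \<tau> / 4) * qpoch (ee (\<tau> / 2)) (ee \<tau>) ^ 2"
    and "theta \<tau> ((1 + \<tau>) / 2) = \<i> * ee (- \<tau> / 4) * qpoch (- ee (\<tau> / 2)) (ee \<tau>) ^ 2"
proof -
  note rec = qpoch_rec[OF norm_ee_less_1[OF assms]]
  have mq: "ee (- 1 / 4) = - \<i>"
    using ee_minus[of "1 / 4"] by (simp add: ee_quarter)
  have "theta \<tau> (1 / 2) = (ee (1 / 4) - ee (- 1 / 4)) * qpoch (- ee \<tau>) (ee \<tau>) ^ 2"
    unfolding theta_def by (simp add: ee_add ee_diff ee_half power2_eq_square)
  then show "theta \<tau> (1 / 2) = 2 * \<i> * qpoch (- ee \<tau>) (ee \<tau>) ^ 2"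
    unfolding ee_quarter mq by simp
  define s where "s = ee (\<tau> / 4)"
  have s: "s \<noteq> 0" "ee (- \<tau> / 4) = 1 / s"
    by (simp_all add: s_def ee_minus)
  have s': "ee (- (\<tau> / 4)) = 1 / s"
    by (simp add: s_def ee_minus)
  have s2: "ee (\<tau> / 2) = s\<^sup>2" and s4: "ee \<tau> = s ^ 4"
    by (simp_all add: s_def ee_power)
  have a: "\<tau> + \<tau> / 2 = \<tau> / 2 + \<tau>" "\<tau> - \<tau> / 2 = \<tau> / 2"
      "\<tau> / 2 / 2 = \<tau> / 4" "- (\<tau> / 2) / 2 = - \<tau> / 4"
    by simp_all
  have "theta \<tau> (\<tau> / 2) = (s - 1 / s) * qpoch (s\<^sup>2 * ee \<tau>) (ee \<tau>) * qpoch (s\<^sup>2) (ee \<tau>)"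
    unfolding theta_def a ee_add s2 s s_def[symmetric] by (rule refl)
  \<comment> \<open>The factor \<open>1 - s\<^sup>2\<close> is the missing first factor of the
    product starting at \<open>s\<^sup>2 * ee \<tau>\<close>; hence both products agree and give a
    square.\<close>
  also have "s - 1 / s = - (1 / s) * (1 - s\<^sup>2)"
    using s by (simp add: field_simps power2_eq_square)
  finally show "theta \<tau> (\<tau> / 2) = - ee (- \<tau> / 4) * qpoch (ee (\<tau> / 2)) (ee \<tau>) ^ 2"
    using rec[of "s\<^sup>2"] by (simp add: s s' s2 power2_eq_square)
  have b: "\<tau> + (1 + \<tau>) / 2 = \<tau> / 2 + \<tau> + 1 / 2" "\<tau> - (1 + \<tau>) / 2 = \<tau> / 2 - 1 / 2"
      "(1 + \<tau>) / 2 / 2 = 1 / 4 + \<tau> / 4" "- ((1 + \<tau>) / 2) / 2 = - (1 / 4) - \<tau> / 4"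
    by (simp_all add: field_simps)
  have "theta \<tau> ((1 + \<tau>) / 2) = (\<i> * s + \<i> / s) * qpoch (- s\<^sup>2 * ee \<tau>) (ee \<tau>) * qpoch (- s\<^sup>2) (ee \<tau>)"
    unfolding theta_def b ee_add ee_diff ee_minus ee_half ee_quarter s2 s_def[symmetric] by simp
  also have "\<i> * s + \<i> / s = \<i> * (1 / s) * (1 - - s\<^sup>2)"
    using s by (simp add: field_simps power2_eq_square)
  finally show "theta \<tau> ((1 + \<tau>) / 2) = \<i> * ee (- \<tau> / 4) * qpoch (- ee (\<tau> / 2)) (ee \<tau>) ^ 2"
    using rec[of "- s\<^sup>2"] by (simp add: s s' s2 power2_eq_square)
qed

section \<open>Elliptic functions and Liouville's theorem\<close>

lemma periodic_of_int:
  fixes w :: complex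
  assumes "\<And>z. f (z + w) = f z"
  shows "f (z + of_int n * w) = f z"
proof -
  have nat: "f (z + of_nat k * w) = f z" for z k
  proof (induction k)
    case (Suc k)
    have "f (z + of_nat (Suc k) * w) = f ((z + of_nat k * w) + w)"
      by (simp add: algebra_simps)
    then show ?case
      by (simp only: assms Suc)
  qed simp
  show ?thesis
  proof (cases n)
    case (nonneg k)
    then show ?thesis using nat[of z k] by simp
  next
    case (neg k)
    then have "complex_of_int n = - of_nat (Suc k)"
      by (simp only: of_int_minus of_int_of_nat_eq)
    then have "z + of_int n * w + of_nat (Suc k) * w = z"
      by (simp only:) (simp add: algebra_simps)
    then show ?thesis
      using nat[of "z + of_int n * w" "Suc k"] by (simp only:)
  qed
qed

text \<open>Reducing both lattice coordinates modulo 1 brings every value into the image of the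
  closed unit square, which is compact.\<close>

lemma doubly_periodic_bounded:
  fixes f :: "complex \<Rightarrow> complex"
  assumes "Im \<tau> > 0" and "continuous_on UNIV f"
    and 1: "\<And>z. f (z + 1) = f z" and \<tau>: "\<And>z. f (z + \<tau>) = f z"
  shows "bounded (range f)"
proof -
  define g where "g x = f (of_real (fst x) + of_real (snd x) * \<tau>)" for x
  have "range f \<subseteq> g ` ({0..1} \<times> {0..1})"
  proof (rule image_subsetI)
    fix z
    define t where "t = Im z / Im \<tau>"
    define s where "s = Re z - t * Re \<tau>"
    have z: "z = of_real s + of_real t * \<tau>"
      using assms(1) by (simp add: complex_eq_iff s_def t_def)
    have "f z = f (of_real (frac s) + of_real (frac t) * \<tau> + of_int \<lfloor>t\<rfloor> * \<tau> + of_int \<lfloor>s\<rfloor> * 1)"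
      by (rule arg_cong[of _ _ f]) (simp add: z frac_def algebra_simps)
    also have "\<dots> = g (frac s, frac t)"
      by (simp only: periodic_of_int[of f, OF 1] periodic_of_int[of f, OF \<tau>] g_def fst_conv snd_conv)
    finally show "f z \<in> g ` ({0..1} \<times> {0..1})"
      by (auto intro!: image_eqI[of _ _ "(frac s, frac t)"] simp: frac_lt_1 less_imp_le)
  qed
  moreover have "compact (g ` ({0..1} \<times> {0..1}))"
    unfolding g_def
    by (intro compact_continuous_image compact_Times compact_Icc
        continuous_on_compose2[OF assms(2)] continuous_intros) auto
  ultimately show ?thesis
    using bounded_subset compact_imp_bounded by blast
qed

text \<open>Equal multipliers make \<open>N z / D z\<close> doubly periodic. Its singularities lie
  at lattice points and are removable, since \<open>D\<close> has a simple zero at 0 and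
  \<open>N\<close> vanishes there too. Liouville's theorem applies, and the constant is the limit at
  0.\<close>

lemma quotient_of_quasiperiodic_constant:
  fixes N D :: "complex \<Rightarrow> complex"
  assumes im: "Im \<tau> > 0" and hol: "N holomorphic_on UNIV" "D holomorphic_on UNIV"
    and one: "\<And>z. N (z + 1) = a z * N z" "\<And>z. D (z + 1) = a z * D z" "\<And>z. a z \<noteq> 0"
    and tau: "\<And>z. N (z + \<tau>) = b z * N z" "\<And>z. D (z + \<tau>) = b z * D z" "\<And>z. b z \<noteq> 0"
    and zeros: "\<And>z. D z = 0 \<Longrightarrow> \<exists>m n. z = of_int m + of_int n * \<tau>"
    and at_0: "N 0 = 0" "D 0 = 0"
    and deriv: "(N has_field_derivative N') (at 0)" "(D has_field_derivative D') (at 0)" "D' \<noteq> 0"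
  shows "N z = N' / D' * D z"
proof -
  define c where "c = N' / D'"
  \<comment> \<open>The value \<open>c\<close> at the zeros of \<open>D\<close> is the limit of the
    quotient at 0, so \<open>K\<close> is the holomorphic extension.\<close>
  define K where "K z = (if D z = 0 then c else N z / D z)" for z
  have per: "K (z + 1) = K z" "K (z + \<tau>) = K z" for z
    by (simp_all add: K_def one tau)
  have lattice: "K (z + of_int m + of_int n * \<tau>) = K z" for z m n
    using periodic_of_int[of K 1 z m] periodic_of_int[of K \<tau> "z + of_int m" n] per by simp
  have lim: "(\<lambda>h. N h / h) \<midarrow>0\<rightarrow> N'" "(\<lambda>h. D h / h) \<midarrow>0\<rightarrow> D'"
    using deriv(1,2) by (simp_all add: DERIV_def at_0)
  have "eventually (\<lambda>h. D h / h \<noteq> 0) (at 0)"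
    by (rule tendsto_imp_eventually_ne[OF lim(2) deriv(3)])
  then obtain r where r: "r > 0" "\<And>h. h \<noteq> 0 \<Longrightarrow> dist h 0 < r \<Longrightarrow> D h / h \<noteq> 0"
    unfolding eventually_at by auto
  have nz: "D h \<noteq> 0" if "h \<in> ball 0 r - {0}" for h
    using r(2)[of h] that by auto
  have "(\<lambda>h. (N h / h) / (D h / h)) \<midarrow>0\<rightarrow> c"
    unfolding c_def by (intro tendsto_divide lim deriv)
  then have "(\<lambda>h. N h / D h) \<midarrow>0\<rightarrow> c"
    by (rule Lim_transform_eventually) (auto simp: eventually_at_filter)
  then have "(\<lambda>y. if y = 0 then c else N y / D y) holomorphic_on ball 0 r"
    using nz by (intro removable_singularity holomorphic_intros holomorphic_on_subset[OF hol(1)]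
        holomorphic_on_subset[OF hol(2)]) auto
  then have "K holomorphic_on ball 0 r"
    by (rule holomorphic_transform) (use nz at_0 in \<open>auto simp: K_def\<close>)
  then have K0: "K field_differentiable at 0"
    using r(1) by (simp add: holomorphic_on_imp_differentiable_at)
  have "K field_differentiable at z" for z
  proof (cases "D z = 0")
    case True
    then obtain m n where z: "z = of_int m + of_int n * \<tau>"
      using zeros by blast
    \<comment> \<open>Differentiability at 0 is carried to the lattice point \<open>z\<close> by
      translation.\<close>
    have "K field_differentiable at (z - z)"
      using K0 by simp
    then have "(K \<circ> (\<lambda>w. w - z)) field_differentiable at z"
      by (intro field_differentiable_compose) (auto intro!: derivative_intros field_differentiable_diff)
    moreover have "K \<circ> (\<lambda>w. w - z) = K"
    proof
      show "(K \<circ> (\<lambda>w. w - z)) w = K w" for w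
        using lattice[of "w - z" m n] by (simp add: z algebra_simps)
    qed
    ultimately show ?thesis by simp
  next
    case False
    have "open {w. D w \<noteq> 0}"
      using continuous_on_open_vimage[of UNIV D] holomorphic_on_imp_continuous_on[OF hol(2)]
      by (auto simp: vimage_def dest!: spec[of _ "- {0}"])
    moreover have "K holomorphic_on {w. D w \<noteq> 0}"
      by (rule holomorphic_transform[of "\<lambda>w. N w / D w"])
         (auto simp: K_def intro!: holomorphic_intros holomorphic_on_subset[OF hol(1)]
           holomorphic_on_subset[OF hol(2)])
    ultimately show ?thesis
      using False by (simp add: holomorphic_on_imp_differentiable_at)
  qed
  then have holK: "K holomorphic_on UNIV"
    by (simp add: holomorphic_on_def)
  have "K constant_on UNIV"
    by (intro Liouville_theorem holK doubly_periodic_bounded[OF im] holomorphic_on_imp_continuous_on per)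
  then have "K z = K 0"
    by (auto simp: constant_on_def)
  then have "N z = c * D z" if "D z \<noteq> 0"
    using that at_0 by (simp add: K_def field_simps)
  \<comment> \<open>\<open>K\<close> was prescribed at the zeros of \<open>D\<close> and says
    nothing about \<open>N\<close> there. The vanishing of \<open>N\<close> spreads from 0 by
    viewing the predicate \<open>N z = 0\<close> as a periodic function.\<close>
  moreover have "N z = 0" if Dz: "D z = 0"
  proof -
    obtain m n where z: "z = of_int m + of_int n * \<tau>"
      using zeros[OF Dz] by blast
    show ?thesis
      using periodic_of_int[of "\<lambda>z. N z = 0" 1 0 m] periodic_of_int[of "\<lambda>z. N z = 0" \<tau> "of_int m" n]
      by (simp add: one tau at_0 z)
  qed
  ultimately show ?thesis
    by (cases "D z = 0") (simp_all add: c_def)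
qed

section \<open>Inversion of theta and eta\<close>

lemma Im_minus_inverse: "Im (- 1 / \<tau>) = Im \<tau> / (norm \<tau>)\<^sup>2"
  by (simp add: Im_divide cmod_power2)

lemma Im_minus_inverse_pos:
  assumes "Im \<tau> > 0"
  shows "Im (- 1 / \<tau>) > 0"
proof -
  have "\<tau> \<noteq> 0" using assms by auto
  then show ?thesis
    unfolding Im_minus_inverse using assms by simp
qed

text \<open>With t = -1/tau, division by \<open>\<tau>\<close> turns the periods 1 and
  \<open>\<tau>\<close> into -t and 1. The Gaussian factor corrects the multipliers, so that both
  sides have the same quasi-periods; the constant is the ratio of the derivatives at 0.\<close>

lemma theta_inversion:
  assumes im: "Im \<tau> > 0"
  shows "ee (- z\<^sup>2 / (2 * \<tau>)) * theta (- 1 / \<tau>) (z / \<tau>) =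
    euler_phi (ee (- 1 / \<tau>)) ^ 2 / (\<tau> * euler_phi (ee \<tau>) ^ 2) * theta \<tau> z"
proof -
  define t where "t = - 1 / \<tau>"
  have t0: "\<tau> \<noteq> 0" using im by auto
  have imt: "Im t > 0" unfolding t_def by (rule Im_minus_inverse_pos[OF im])
  define N where "N z = ee (- z\<^sup>2 / (2 * \<tau>)) * theta t (z / \<tau>)" for z
  have N1: "N (z + 1) = -1 * N z" for z
  proof -
    have "(z + 1) / \<tau> = z / \<tau> - t"
      by (simp add: t_def add_divide_distrib)
    then have "N (z + 1) = ee (- (z + 1)\<^sup>2 / (2 * \<tau>)) * (- ee (z / \<tau> - t / 2) * theta t (z / \<tau>))"
      unfolding N_def using theta_diff_tau[OF imt] by simp
    also have "\<dots> = - (ee (- (z + 1)\<^sup>2 / (2 * \<tau>)) * ee (z / \<tau> - t / 2)) * theta t (z / \<tau>)"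
      by simp
    also have "ee (- (z + 1)\<^sup>2 / (2 * \<tau>)) * ee (z / \<tau> - t / 2) = ee (- z\<^sup>2 / (2 * \<tau>))"
      unfolding ee_add[symmetric]
      by (rule arg_cong[of _ _ ee]) (use t0 in \<open>simp add: t_def field_simps power2_eq_square\<close>)
    finally show ?thesis by (simp add: N_def)
  qed
  have Nt: "N (z + \<tau>) = - ee (- \<tau> / 2 - z) * N z" for z
  proof -
    have "(z + \<tau>) / \<tau> = z / \<tau> + 1"
      using t0 by (simp add: add_divide_distrib)
    then have "N (z + \<tau>) = - ee (- (z + \<tau>)\<^sup>2 / (2 * \<tau>)) * theta t (z / \<tau>)"
      unfolding N_def using theta_add_1[of t "z / \<tau>"] by simp
    also have "ee (- (z + \<tau>)\<^sup>2 / (2 * \<tau>)) = ee (- \<tau> / 2 - z) * ee (- z\<^sup>2 / (2 * \<tau>))"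
      unfolding ee_add[symmetric]
      by (rule arg_cong[of _ _ ee]) (use t0 in \<open>simp add: field_simps power2_eq_square\<close>)
    finally show ?thesis by (simp add: N_def)
  qed
  have thetat: "(\<lambda>z. theta t (z / \<tau>)) holomorphic_on UNIV"
    by (intro holomorphic_theta[OF imt] holomorphic_intros) (use t0 in auto)
  have "(theta t has_field_derivative 2 * of_real pi * \<i> * euler_phi (ee t) ^ 2) (at (0 / \<tau>))"
    using has_field_derivative_theta_0[OF imt] by simp
  then have "((\<lambda>z. theta t (z / \<tau>)) has_field_derivative
      2 * of_real pi * \<i> * euler_phi (ee t) ^ 2 * (1 / \<tau>)) (at 0)"
    by (rule DERIV_chain2) (use t0 in \<open>auto intro!: derivative_eq_intros\<close>)
  moreover have "((\<lambda>z. ee (- z\<^sup>2 / (2 * \<tau>))) has_field_derivative 0) (at 0)"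
    using t0 by (auto intro!: derivative_eq_intros)
  ultimately have "(N has_field_derivative
      0 * theta t (0 / \<tau>) + 2 * of_real pi * \<i> * euler_phi (ee t) ^ 2 * (1 / \<tau>) * ee (- 0\<^sup>2 / (2 * \<tau>))) (at 0)"
    unfolding N_def[abs_def] by (intro DERIV_mult)
  then have dN: "(N has_field_derivative 2 * of_real pi * \<i> * euler_phi (ee t) ^ 2 / \<tau>) (at 0)"
    by simp
  have "N z = (2 * of_real pi * \<i> * euler_phi (ee t) ^ 2 / \<tau>) / (2 * of_real pi * \<i> * euler_phi (ee \<tau>) ^ 2) * theta \<tau> z"
  proof (rule quotient_of_quasiperiodic_constant[OF im _ _ N1 _ _ Nt])
    show "N holomorphic_on UNIV"
      unfolding N_def[abs_def] by (intro holomorphic_intros thetat) (use t0 in auto)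
    show "theta \<tau> holomorphic_on UNIV"
      using holomorphic_theta[OF im, of "\<lambda>z. z" UNIV] by simp
    show "theta \<tau> (z + 1) = -1 * theta \<tau> z" for z
      by (simp add: theta_add_1)
    show "theta \<tau> (z + \<tau>) = - ee (- \<tau> / 2 - z) * theta \<tau> z" for z
      by (rule theta_add_tau[OF im])
    show "\<exists>m n. z = of_int m + of_int n * \<tau>" if "theta \<tau> z = 0" for z
      using theta_eq_0D[OF im that] by blast
    show "N 0 = 0" "theta \<tau> 0 = 0"
      by (simp_all add: N_def theta_0)
    show "(theta \<tau> has_field_derivative 2 * of_real pi * \<i> * euler_phi (ee \<tau>) ^ 2) (at 0)"
      by (rule has_field_derivative_theta_0[OF im])
    show "2 * of_real pi * \<i> * euler_phi (ee \<tau>) ^ 2 \<noteq> 0"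
      using euler_phi_nonzero[OF norm_ee_less_1[OF im]] by simp
  qed (use dN in simp_all)
  then show ?thesis
    by (simp add: N_def t_def)
qed

text \<open>The square of Dedekind's eta, as \<open>dedekind_eta_squared\<close> confirms. Its
  inversion multiplier \<open>- \<i> * \<tau>\<close> is single-valued, so no branch of a square
  root has to be chosen.\<close>

definition eta_sq :: "complex \<Rightarrow> complex" where
  "eta_sq \<tau> = ee (\<tau> / 12) * euler_phi (ee \<tau>) ^ 2"

text \<open>Evaluating the theta inversion at the three half periods and multiplying eliminates Weber's
  functions, whose product is trivial, and leaves the multiplier of the inversion cubed.\<close>

lemma eta_sq_cube_inversion:
  assumes im: "Im \<tau> > 0"
  shows "eta_sq (- 1 / \<tau>) ^ 3 = (- \<i> * \<tau> * eta_sq \<tau>) ^ 3"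
proof -
  define t where "t = - 1 / \<tau>"
  define c where "c = euler_phi (ee t) ^ 2 / (\<tau> * euler_phi (ee \<tau>) ^ 2)"
  have t0: "\<tau> \<noteq> 0" using im by auto
  have imt: "Im t > 0" unfolding t_def by (rule Im_minus_inverse_pos[OF im])
  note inv = theta_inversion[OF im, folded t_def, folded c_def]
  \<comment> \<open>Eighths arise as values of the Gaussian factor at the half periods.\<close>
  define s s' where "s = ee (\<tau> / 8)" and "s' = ee (t / 8)"
  have s: "s \<noteq> 0" "s' \<noteq> 0" by (simp_all add: s_def s'_def)
  have e: "ee (- \<tau> / 8) = 1 / s" "ee (- \<tau> / 4) = 1 / s\<^sup>2" "ee (- t / 4) = 1 / s'\<^sup>2"
    by (simp_all add: s_def s'_def ee_minus ee_power)
  define A where "A \<tau> = qpoch (- ee \<tau>) (ee \<tau>)" for \<tau>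
  define B where "B \<tau> = qpoch (ee (\<tau> / 2)) (ee \<tau>)" for \<tau>
  define C where "C \<tau> = qpoch (- ee (\<tau> / 2)) (ee \<tau>)" for \<tau>
  have ABC: "A u * B u * C u = 1" if "Im u > 0" for u
    using qpoch_mult_uminus[OF norm_ee_less_1[OF that], of "ee (u / 2)"]
      qpoch_weber_product[OF norm_ee_less_1[OF that]]
    by (simp add: A_def B_def C_def ee_power mult_ac)
  \<comment> \<open>The half period 1/2 goes to -t/2 and, in the next step,
    \<open>\<tau> / 2\<close> goes to 1/2: the inversion exchanges \<open>A\<close> and
    \<open>B\<close>.\<close>
  have 1: "B t ^ 2 = 2 * \<i> * c * s' * A \<tau> ^ 2"
  proof -
    have "theta t (1 / 2 / \<tau>) = theta t (- (t / 2))"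
      by (simp add: t_def mult.commute)
    also have "\<dots> = 1 / s'\<^sup>2 * B t ^ 2"
      unfolding theta_uminus theta_half(2)[OF imt] e B_def by simp
    moreover have "ee (- (1 / 2)\<^sup>2 / (2 * \<tau>)) = s'"
      unfolding s'_def by (rule arg_cong[of _ _ ee]) (simp add: t_def power2_eq_square)
    ultimately show ?thesis
      using inv[of "1 / 2"] s unfolding theta_half(1)[OF im] A_def
      by (simp add: field_simps power2_eq_square)
  qed
  have 2: "2 * \<i> * s * A t ^ 2 = - c * B \<tau> ^ 2"
  proof -
    have a: "ee (- (\<tau> / 2)\<^sup>2 / (2 * \<tau>)) = 1 / s"
      unfolding e(1)[symmetric] by (rule arg_cong[of _ _ ee]) (use t0 in \<open>simp add: power2_eq_square\<close>)
    have b: "\<tau> / 2 / \<tau> = 1 / 2" using t0 by simp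
    show ?thesis
      using inv[of "\<tau> / 2"] s unfolding a b theta_half(1)[OF imt] theta_half(2)[OF im] e A_def B_def
      by (simp add: field_simps power2_eq_square)
  qed
  \<comment> \<open>The third half period goes to its own analogue up to sign and a translation by
    1, so \<open>C\<close> is matched with itself.\<close>
  have 3: "s * C t ^ 2 = \<i> * c * s' * C \<tau> ^ 2"
  proof -
    have "ee (- ((1 + \<tau>) / 2)\<^sup>2 / (2 * \<tau>)) = ee (t / 8 + - (1 / 4) + - \<tau> / 8)"
      by (rule arg_cong[of _ _ ee]) (use t0 in \<open>simp add: t_def field_simps power2_eq_square\<close>)
    also have "\<dots> = s' * (1 / \<i>) * (1 / s)"
      unfolding ee_add e ee_minus ee_quarter s'_def by (rule refl)
    finally have a: "ee (- ((1 + \<tau>) / 2)\<^sup>2 / (2 * \<tau>)) = s' * (1 / \<i>) * (1 / s)" .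
    have b: "(1 + \<tau>) / 2 / \<tau> = - ((1 + t) / 2) + 1"
      using t0 by (simp add: t_def field_simps)
    show ?thesis
      using inv[of "(1 + \<tau>) / 2"] s
      unfolding a b theta_add_1 theta_uminus theta_half(3)[OF im] theta_half(3)[OF imt] e C_def
      by (simp add: field_simps power2_eq_square)
  qed
  have "2 * \<i> * s\<^sup>2 * (A t * B t * C t) ^ 2 = (2 * \<i> * s * A t ^ 2) * B t ^ 2 * (s * C t ^ 2)"
    by (simp add: power2_eq_square mult_ac)
  also have "\<dots> = 2 * c ^ 3 * s'\<^sup>2 * (A \<tau> * B \<tau> * C \<tau>) ^ 2"
    unfolding 1 2 3 by (simp add: power2_eq_square power3_eq_cube)
  finally have cube: "c ^ 3 * s'\<^sup>2 = \<i> * s\<^sup>2"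
    by (simp add: ABC im imt)
  have d: "euler_phi (ee \<tau>) \<noteq> 0" using euler_phi_nonzero[OF norm_ee_less_1[OF im]] .
  then have "eta_sq t = ee (t / 12) * (c * \<tau> * euler_phi (ee \<tau>) ^ 2)"
    unfolding eta_sq_def c_def using t0 by simp
  then have "eta_sq t ^ 3 = ee (t / 12) ^ 3 * c ^ 3 * \<tau> ^ 3 * euler_phi (ee \<tau>) ^ 6"
    by (simp add: power_mult_distrib flip: power_mult)
  also have "ee (t / 12) ^ 3 = s'\<^sup>2"
    by (simp add: ee_power s'_def)
  also have "s'\<^sup>2 * c ^ 3 = \<i> * s\<^sup>2"
    using cube by (simp add: mult.commute)
  also have "s\<^sup>2 = ee (\<tau> / 12) ^ 3"
    by (simp add: ee_power s_def)
  also have "\<i> * ee (\<tau> / 12) ^ 3 * \<tau> ^ 3 * euler_phi (ee \<tau>) ^ 6 = (- \<i> * \<tau> * eta_sq \<tau>) ^ 3"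
  proof -
    have "\<i> ^ 3 = - \<i>" by (simp add: power3_eq_cube)
    then show ?thesis
      by (simp add: eta_sq_def power_mult_distrib mult_ac flip: power_mult)
  qed
  finally show ?thesis by (simp add: t_def)
qed

abbreviation upper_half_plane :: "complex set" where
  "upper_half_plane \<equiv> {\<tau>. Im \<tau> > 0}"

lemma connected_upper_half_plane: "connected upper_half_plane"
  using convex_connected[OF convex_halfspace_Im_gt[of 0]] .

lemma eta_sq_nonzero: "Im \<tau> > 0 \<Longrightarrow> eta_sq \<tau> \<noteq> 0"
  using euler_phi_nonzero[OF norm_ee_less_1] by (simp add: eta_sq_def)

lemma holomorphic_eta_sq:
  assumes "f holomorphic_on A" "\<And>z. z \<in> A \<Longrightarrow> Im (f z) > 0"
  shows "(\<lambda>z. eta_sq (f z)) holomorphic_on A"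
proof -
  have "(euler_phi \<circ> (\<lambda>z. ee (f z))) holomorphic_on A"
    by (rule holomorphic_on_compose_gen[OF _ holomorphic_euler_phi])
       (use assms in \<open>auto intro!: holomorphic_intros\<close>)
  then have "(\<lambda>z. euler_phi (ee (f z))) holomorphic_on A"
    by (simp add: o_def)
  then show ?thesis
    unfolding eta_sq_def by (intro holomorphic_intros assms) auto
qed

lemma eta_sq_add_1: "eta_sq (\<tau> + 1) = ee (1 / 12) * eta_sq \<tau>"
  by (simp add: eta_sq_def ee_add add_divide_distrib mult_ac)

text \<open>The ratio of the two sides is continuous on a connected set and takes only cube roots of
  unity as values, so it is constant. The fixed point \<open>\<i>\<close> of the inversion gives the
  value 1.\<close>

lemma eta_sq_inversion:
  assumes "Im \<tau> > 0"
  shows "eta_sq (- 1 / \<tau>) = - \<i> * \<tau> * eta_sq \<tau>"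
proof -
  let ?H = upper_half_plane
  define \<rho> where "\<rho> z = eta_sq (- 1 / z) / (- \<i> * z * eta_sq z)" for z
  have nz: "- \<i> * z * eta_sq z \<noteq> 0" if "z \<in> ?H" for z
    using that eta_sq_nonzero[of z] by auto
  have "\<rho> holomorphic_on ?H"
    unfolding \<rho>_def
    by (intro holomorphic_intros holomorphic_eta_sq nz) (auto simp: Im_minus_inverse_pos simp del: divide_minus_left)
  moreover have "\<rho> z ^ 3 = 1" if "z \<in> ?H" for z
    using eta_sq_cube_inversion[of z] nz[OF that] that by (simp add: \<rho>_def power_divide del: power_mult_distrib)
  then have "\<rho> ` ?H \<subseteq> {z. z ^ 3 = 1}"
    by auto
  then have "finite (\<rho> ` ?H)"
    using finite_roots_unity[of 3, where 'a = complex] finite_subset by auto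
  ultimately have "\<rho> constant_on ?H"
    by (intro continuous_finite_range_constant connected_upper_half_plane holomorphic_on_imp_continuous_on)
  then have "\<rho> \<tau> = \<rho> \<i>"
    using assms by (auto simp: constant_on_def)
  also have "\<rho> \<i> = 1"
    using eta_sq_nonzero[of \<i>] by (simp add: \<rho>_def)
  finally show ?thesis
    using nz[of \<tau>] assms unfolding \<rho>_def by (simp only: divide_eq_1_iff mem_Collect_eq)
qed

section \<open>A maximum principle for functions on the upper half plane\<close>

text \<open>The members of the family may be permuted by the transformations that raise the imaginary part, so
  a group with several cusps needs to be examined at the cusp at infinity only.\<close>

lemma modular_family_eq_0:
  fixes F :: "'i \<Rightarrow> complex \<Rightarrow> complex" and c \<delta> k :: real
  assumes "finite I" and hol: "\<And>i. i \<in> I \<Longrightarrow> F i holomorphic_on upper_half_plane"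
    and period: "\<And>i \<tau>. i \<in> I \<Longrightarrow> Im \<tau> > 0 \<Longrightarrow> norm (F i (\<tau> + 1)) = norm (F i \<tau>)"
    and cusp: "\<And>i. i \<in> I \<Longrightarrow> (F i \<longlongrightarrow> 0) (filtercomap Im at_top)"
    and "\<delta> > 0" and "k > 1"
    and raise: "\<And>\<tau>. c \<le> Re \<tau> \<Longrightarrow> Re \<tau> \<le> c + 1 \<Longrightarrow> 0 < Im \<tau> \<Longrightarrow> Im \<tau> < \<delta> \<Longrightarrow>
      \<exists>\<tau>'. Im \<tau>' \<ge> k * Im \<tau> \<and> (\<forall>i\<in>I. \<exists>j\<in>I. norm (F i \<tau>) = norm (F j \<tau>'))"
    and "i \<in> I" and "Im \<tau> > 0"
  shows "F i \<tau> = 0"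
proof (rule ccontr)
  assume "F i \<tau> \<noteq> 0"
  define m where "m = norm (F i \<tau>)"
  have m: "m > 0" using \<open>F i \<tau> \<noteq> 0\<close> by (simp add: m_def)
  have strip: "\<exists>\<sigma>. c \<le> Re \<sigma> \<and> Re \<sigma> \<le> c + 1 \<and> Im \<sigma> = Im \<tau> \<and> (\<forall>i\<in>I. norm (F i \<tau>) = norm (F i \<sigma>))"
    if "Im \<tau> > 0" for \<tau>
  proof -
    define n where "n = \<lfloor>Re \<tau> - c\<rfloor>"
    \<comment> \<open>Periodicity is known on the upper half plane only; extending the norm by 0
      makes \<open>periodic_of_int\<close> applicable.\<close>
    have "norm (F i \<tau>) = norm (F i (\<tau> + of_int (- n) * 1))" if "i \<in> I" for i
      using periodic_of_int[of "\<lambda>z. if Im z > 0 then norm (F i z) else 0" 1 \<tau> "- n"]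
        period[OF that] \<open>Im \<tau> > 0\<close> by simp
    moreover have "c \<le> Re \<tau> - of_int n" "Re \<tau> - of_int n \<le> c + 1"
      unfolding n_def by linarith+
    ultimately show ?thesis
      by (intro exI[of _ "\<tau> + of_int (- n) * 1"]) simp
  qed
  \<comment> \<open>Each raise multiplies the height by at least \<open>k\<close>, so
    \<open>n\<close> bounds the number of raises needed to reach height
    \<open>\<delta>\<close>.\<close>
  have "\<exists>\<sigma> j. j \<in> I \<and> c \<le> Re \<sigma> \<and> Re \<sigma> \<le> c + 1 \<and> \<delta> \<le> Im \<sigma> \<and> norm (F i \<tau>) = norm (F j \<sigma>)"
    if "Im \<tau> > 0" "Im \<tau> * k ^ n \<ge> \<delta>" "i \<in> I" for n i \<tau>
    using that
  proof (induction n arbitrary: \<tau> i)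
    case 0
    then show ?case using strip[of \<tau>] by force
  next
    case (Suc n)
    obtain \<sigma> where \<sigma>: "c \<le> Re \<sigma>" "Re \<sigma> \<le> c + 1" "Im \<sigma> = Im \<tau>" "norm (F i \<tau>) = norm (F i \<sigma>)"
      using strip[of \<tau>] Suc.prems by blast
    show ?case
    proof (cases "Im \<sigma> < \<delta>")
      case True
      obtain \<tau>' j where \<tau>': "Im \<tau>' \<ge> k * Im \<sigma>" "j \<in> I" "norm (F i \<sigma>) = norm (F j \<tau>')"
        using raise[OF \<sigma>(1,2) _ True] Suc.prems(1,3) \<sigma>(3) by metis
      have "0 < k * Im \<sigma>"
        using \<open>k > 1\<close> Suc.prems(1) \<sigma>(3) by simp
      moreover have "\<delta> \<le> Im \<tau>' * k ^ n"
      proof -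
        have "\<delta> \<le> (k * Im \<sigma>) * k ^ n"
          using Suc.prems(2) \<sigma>(3) by (simp add: mult_ac)
        also have "\<dots> \<le> Im \<tau>' * k ^ n"
          using \<tau>'(1) \<open>k > 1\<close> by (intro mult_right_mono) auto
        finally show ?thesis .
      qed
      ultimately show ?thesis
        using Suc.IH[of \<tau>' j] \<tau>' \<sigma>(4) by simp
    qed (use \<sigma> Suc.prems(3) in force)
  qed
  moreover have "\<exists>n. Im \<tau> * k ^ n \<ge> \<delta>" if "Im \<tau> > 0" for \<tau>
    using real_arch_pow[OF \<open>k > 1\<close>, of "\<delta> / Im \<tau>"] that by (auto simp: field_simps intro: less_imp_le)
  ultimately have reduce: "\<exists>\<sigma> j. j \<in> I \<and> c \<le> Re \<sigma> \<and> Re \<sigma> \<le> c + 1 \<and> \<delta> \<le> Im \<sigma> \<and> norm (F i \<tau>) = norm (F j \<sigma>)"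
    if "Im \<tau> > 0" "i \<in> I" for i \<tau>
    using that by blast
  have "eventually (\<lambda>\<tau>. norm (F i \<tau>) < m) (filtercomap Im at_top)" if "i \<in> I" for i
    using tendstoD[OF cusp[OF that] m] by simp
  then have "eventually (\<lambda>\<tau>. \<forall>i\<in>I. norm (F i \<tau>) < m) (filtercomap Im at_top)"
    using assms(1) by (simp add: eventually_ball_finite)
  then obtain B0 where B0: "\<And>\<tau> i. Im \<tau> \<ge> B0 \<Longrightarrow> i \<in> I \<Longrightarrow> norm (F i \<tau>) < m"
    unfolding eventually_filtercomap eventually_at_top_linorder by blast
  \<comment> \<open>From height \<open>B\<close> on all members are smaller than \<open>m\<close>,
    so values of norm at least \<open>m\<close> already occur on the compact rectangle
    \<open>K\<close>.\<close>
  define B where "B = max B0 \<delta>"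
  have B: "norm (F i \<tau>) < m" if "Im \<tau> \<ge> B" "i \<in> I" for i \<tau>
    using B0 that by (simp add: B_def)
  define K where "K = cbox (Complex c \<delta>) (Complex (c + 1) B)"
  have K_iff: "z \<in> K \<longleftrightarrow> c \<le> Re z \<and> Re z \<le> c + 1 \<and> \<delta> \<le> Im z \<and> Im z \<le> B" for z
    by (auto simp: K_def in_cbox_complex_iff)
  have "compact K" "K \<noteq> {}"
    using K_iff[of "Complex c \<delta>"] by (auto simp: K_def[symmetric] B_def) (simp add: K_def)
  have "K \<subseteq> upper_half_plane"
    using \<open>\<delta> > 0\<close> by (auto simp: K_iff)
  have "\<exists>z\<in>K. \<forall>w\<in>K. norm (F j w) \<le> norm (F j z)" if "j \<in> I" for j
    using continuous_attains_sup[OF \<open>compact K\<close> \<open>K \<noteq> {}\<close>, of "\<lambda>z. norm (F j z)"]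
      continuous_on_subset[OF holomorphic_on_imp_continuous_on[OF hol[OF that]] \<open>K \<subseteq> _\<close>]
    by (auto intro: continuous_intros)
  then obtain z where z: "\<And>j. j \<in> I \<Longrightarrow> z j \<in> K" "\<And>j w. j \<in> I \<Longrightarrow> w \<in> K \<Longrightarrow> norm (F j w) \<le> norm (F j (z j))"
    by metis
  \<comment> \<open>The member with the largest maximum on \<open>K\<close> is chosen, because
    \<open>raise\<close> may change the index.\<close>
  obtain j where j: "j \<in> I" "\<And>l. l \<in> I \<Longrightarrow> norm (F l (z l)) \<le> norm (F j (z j))"
  proof -
    have "Max ((\<lambda>l. norm (F l (z l))) ` I) \<in> (\<lambda>l. norm (F l (z l))) ` I"
      using assms(1) \<open>i \<in> I\<close> by (intro Max_in) auto
    then obtain j where "j \<in> I" "norm (F j (z j)) = Max ((\<lambda>l. norm (F l (z l))) ` I)"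
      by auto
    then show thesis
      using assms(1) by (intro that[of j]) simp_all
  qed
  have bound: "norm (F l w) < m \<or> norm (F l w) \<le> norm (F j (z j))" if w: "Im w > 0" "l \<in> I" for l w
  proof -
    obtain \<sigma> l' where *: "l' \<in> I" "c \<le> Re \<sigma>" "Re \<sigma> \<le> c + 1" "\<delta> \<le> Im \<sigma>" "norm (F l w) = norm (F l' \<sigma>)"
      using reduce[OF w] by blast
    show ?thesis
    proof (cases "Im \<sigma> \<le> B")
      case True
      then show ?thesis
        using * z(2)[of l' \<sigma>] j(2)[of l'] by (force simp: K_iff)
    next
      case False
      then show ?thesis using B[of \<sigma> l'] * by simp
    qed
  qed
  have m_le: "m \<le> norm (F j (z j))"
    using bound[of \<tau> i] \<open>i \<in> I\<close> \<open>Im \<tau> > 0\<close> by (simp add: m_def)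
  have "F j constant_on upper_half_plane"
  proof (rule maximum_modulus_principle[OF hol[OF j(1)] _ connected_upper_half_plane _ subset_refl])
    show "open upper_half_plane" by (rule open_halfspace_Im_gt)
    then show "open upper_half_plane" .
    show "z j \<in> upper_half_plane"
      using z(1)[OF j(1)] \<open>K \<subseteq> _\<close> by blast
    show "norm (F j w) \<le> norm (F j (z j))" if "w \<in> upper_half_plane" for w
      using bound[of w j] m_le j(1) that by auto
  qed
  \<comment> \<open>The constant has norm at least \<open>m\<close>, but at height \<open>B\<close>
    the norm is smaller.\<close>
  then have "F j (Complex 0 B) = F j (z j)"
    using z(1)[OF j(1)] \<open>K \<subseteq> _\<close> \<open>\<delta> > 0\<close> by (fastforce simp: constant_on_def B_def)
  then show False
    using B[of "Complex 0 B" j] j(1) m_le by simp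
qed

section \<open>Weber's functions and the Eisenstein series of weight 4\<close>

text \<open>Eighth powers of Weber's functions \<open>\<ff>\<close>, \<open>\<ff>\<^sub>1\<close>, \<open>\<ff>\<^sub>2\<close>.\<close>

definition weber :: "complex \<Rightarrow> complex" where
  "weber \<tau> = eta_sq \<tau> ^ 8 / (eta_sq (\<tau> / 2) ^ 4 * eta_sq (2 * \<tau>) ^ 4)"

definition weber1 :: "complex \<Rightarrow> complex" where
  "weber1 \<tau> = (eta_sq (\<tau> / 2) / eta_sq \<tau>) ^ 4"

definition weber2 :: "complex \<Rightarrow> complex" where
  "weber2 \<tau> = 16 * (eta_sq (2 * \<tau>) / eta_sq \<tau>) ^ 4"

lemma weber_nonzero:
  assumes "Im \<tau> > 0"
  shows "weber \<tau> \<noteq> 0" "weber1 \<tau> \<noteq> 0" "weber2 \<tau> \<noteq> 0"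
  using assms eta_sq_nonzero[of \<tau>] eta_sq_nonzero[of "\<tau> / 2"] eta_sq_nonzero[of "2 * \<tau>"]
  by (simp_all add: weber_def weber1_def weber2_def)

lemma weber_product:
  assumes "Im \<tau> > 0"
  shows "weber \<tau> * weber1 \<tau> * weber2 \<tau> = 16"
  using assms eta_sq_nonzero[of \<tau>] eta_sq_nonzero[of "\<tau> / 2"] eta_sq_nonzero[of "2 * \<tau>"]
  by (simp add: weber_def weber1_def weber2_def field_simps flip: power_add)

text \<open>The inversion exchanges the arguments \<open>\<tau> / 2\<close> and
  \<open>2 * \<tau>\<close> of eta; the 16 in \<open>weber2\<close> is the fourth power of the 2
  that this produces. The third relation follows from the constant product.\<close>

lemma weber_inversion:
  assumes "Im \<tau> > 0"
  shows "weber1 (- 1 / \<tau>) = weber2 \<tau>" "weber2 (- 1 / \<tau>) = weber1 \<tau>" "weber (- 1 / \<tau>) = weber \<tau>"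
proof -
  have t0: "\<tau> \<noteq> 0" using assms by auto
  have h: "eta_sq (- 1 / \<tau> / 2) = - \<i> * (2 * \<tau>) * eta_sq (2 * \<tau>)"
    using eta_sq_inversion[of "2 * \<tau>"] assms by (simp add: mult.commute)
  have d: "eta_sq (2 * (- 1 / \<tau>)) = - \<i> * (\<tau> / 2) * eta_sq (\<tau> / 2)"
    using eta_sq_inversion[of "\<tau> / 2"] assms by (simp add: mult.commute)
  note inv = eta_sq_inversion[OF assms]
  show 1: "weber1 (- 1 / \<tau>) = weber2 \<tau>"
    unfolding weber1_def weber2_def h inv using t0 by (simp add: power_mult_distrib power_divide)
  show 2: "weber2 (- 1 / \<tau>) = weber1 \<tau>"
    unfolding weber1_def weber2_def d inv using t0 by (simp add: power_mult_distrib power_divide)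
  have "weber (- 1 / \<tau>) * weber2 \<tau> * weber1 \<tau> = 16"
    using weber_product[OF Im_minus_inverse_pos[OF assms]] unfolding 1 2 .
  then have "weber (- 1 / \<tau>) * (weber1 \<tau> * weber2 \<tau>) = weber \<tau> * (weber1 \<tau> * weber2 \<tau>)"
    using weber_product[OF assms] by (simp add: mult_ac)
  then show "weber (- 1 / \<tau>) = weber \<tau>"
    using weber_nonzero[OF assms] by simp
qed

text \<open>Translation by 1 moves \<open>\<tau> / 2\<close> by one half only, which
  \<open>eta_sq_add_1\<close> cannot handle; the nome \<open>h\<close> becomes \<open>- h\<close>,
  and \<open>euler_phi_uminus\<close> takes over.\<close>

lemma eta_sq_half_shift:
  assumes "Im \<tau> > 0"
  shows "eta_sq ((\<tau> + 1) / 2) * eta_sq (\<tau> / 2) * eta_sq (2 * \<tau>) = ee (1 / 24) * eta_sq \<tau> ^ 3"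
proof -
  define h where "h = ee (\<tau> / 2)"
  have h: "ee \<tau> = h\<^sup>2" "ee (2 * \<tau>) = h ^ 4" "ee ((\<tau> + 1) / 2) = - h"
    by (simp_all add: h_def ee_power add_divide_distrib ee_add ee_half)
  have "norm h < 1" using assms by (simp add: h_def)
  have "eta_sq ((\<tau> + 1) / 2) * eta_sq (\<tau> / 2) * eta_sq (2 * \<tau>) =
      (ee ((\<tau> + 1) / 2 / 12) * ee (\<tau> / 2 / 12) * ee (2 * \<tau> / 12)) *
      (euler_phi (- h) * euler_phi h * euler_phi (h ^ 4)) ^ 2"
    unfolding eta_sq_def h h_def[symmetric] by (simp add: power2_eq_square mult_ac)
  also have "ee ((\<tau> + 1) / 2 / 12) * ee (\<tau> / 2 / 12) * ee (2 * \<tau> / 12) = ee (1 / 24) * ee (\<tau> / 12) ^ 3"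
    unfolding ee_power ee_add[symmetric] by (rule arg_cong[of _ _ ee]) (simp add: field_simps)
  also have "euler_phi (- h) * euler_phi h * euler_phi (h ^ 4) = euler_phi (h\<^sup>2) ^ 3"
    by (rule euler_phi_uminus) fact
  finally show ?thesis
    by (simp add: eta_sq_def h power_mult_distrib flip: power_mult)
qed

text \<open>Translation swaps \<open>weber\<close> and \<open>weber1\<close> and preserves
  \<open>weber2\<close>. The multipliers agree up to sign, so the defect of Jacobi's identity is
  multiplied by one number of modulus 1.\<close>

lemma weber_add_1:
  assumes "Im \<tau> > 0"
  shows "weber1 (\<tau> + 1) = ee (- 1 / 6) * weber \<tau>"
    and "weber2 (\<tau> + 1) = - ee (- 1 / 6) * weber2 \<tau>"
    and "weber (\<tau> + 1) = ee (- 1 / 6) * weber1 \<tau>"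
proof -
  note nz = eta_sq_nonzero[OF assms] eta_sq_nonzero[of "\<tau> / 2"] eta_sq_nonzero[of "2 * \<tau>"]
  have half: "eta_sq ((\<tau> + 1) / 2) = ee (1 / 24) * eta_sq \<tau> ^ 3 / (eta_sq (\<tau> / 2) * eta_sq (2 * \<tau>))"
    using eta_sq_half_shift[OF assms] nz assms by (simp add: field_simps)
  have a: "ee (1 / 6) / ee (1 / 3) = ee (- 1 / 6)"
    unfolding ee_diff[symmetric] by (rule arg_cong[of _ _ ee]) simp
  have "weber1 (\<tau> + 1) = ee (1 / 6) / ee (1 / 3) * weber \<tau>"
    unfolding weber1_def weber_def half eta_sq_add_1 using nz assms
    by (simp add: power_mult_distrib power_divide ee_power field_simps flip: power_mult power_add)
  then show 1: "weber1 (\<tau> + 1) = ee (- 1 / 6) * weber \<tau>"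
    by (simp only: a)
  have b: "ee (1 / 3) = - ee (- 1 / 6)"
    using ee_add[of "1 / 2" "- 1 / 6"] by (simp add: ee_half)
  have "eta_sq (2 * (\<tau> + 1)) = ee (1 / 6) * eta_sq (2 * \<tau>)"
    using eta_sq_add_1[of "2 * \<tau>"] eta_sq_add_1[of "2 * \<tau> + 1"]
    by (simp add: algebra_simps flip: ee_add)
  then have "weber2 (\<tau> + 1) = ee (2 / 3) / ee (1 / 3) * weber2 \<tau>"
    unfolding weber2_def eta_sq_add_1 by (simp add: power_mult_distrib power_divide ee_power)
  also have "ee (2 / 3) / ee (1 / 3) = ee (1 / 3)"
    unfolding ee_diff[symmetric] by simp
  finally show 2: "weber2 (\<tau> + 1) = - ee (- 1 / 6) * weber2 \<tau>"
    unfolding b .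
  have c: "ee (- 1 / 6) ^ 3 = -1"
    unfolding ee_power using ee_minus[of "1 / 2"] by (simp add: ee_half)
  \<comment> \<open>The remaining relation is read off from the constant product of the three
    functions.\<close>
  have "weber (\<tau> + 1) * (ee (- 1 / 6) * weber \<tau>) * (- ee (- 1 / 6) * weber2 \<tau>) = 16"
    using weber_product[of "\<tau> + 1"] assms unfolding 1 2 by simp
  also have "16 = - (ee (- 1 / 6) ^ 3) * (weber \<tau> * weber1 \<tau> * weber2 \<tau>)"
    using weber_product[OF assms] c by simp
  finally have "(- (ee (- 1 / 6) ^ 2) * weber \<tau> * weber2 \<tau>) * weber (\<tau> + 1) =
      (- (ee (- 1 / 6) ^ 2) * weber \<tau> * weber2 \<tau>) * (ee (- 1 / 6) * weber1 \<tau>)"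
    by (simp add: power2_eq_square power3_eq_cube mult_ac)
  then show "weber (\<tau> + 1) = ee (- 1 / 6) * weber1 \<tau>"
    using weber_nonzero[OF assms] by simp
qed

section \<open>Behaviour at the cusp and Jacobi's identity\<close>

abbreviation cusp_filter :: "complex filter" where
  "cusp_filter \<equiv> filtercomap Im at_top"

lemma eventually_cusp_filter: "eventually (\<lambda>\<tau>. Im \<tau> > 0) cusp_filter"
  by (rule eventually_filtercomapI[OF eventually_gt_at_top])

lemma ee_tendsto_0_cusp:
  assumes "c > 0"
  shows "((\<lambda>\<tau>. ee (of_real c * \<tau>)) \<longlongrightarrow> 0) cusp_filter"
proof (rule tendsto_norm_zero_cancel)
  have "((\<lambda>y. exp (- (2 * pi * (c * y)))) \<longlongrightarrow> 0) at_top"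
    using assms by real_asymp
  then show "((\<lambda>\<tau>. norm (ee (of_real c * \<tau>))) \<longlongrightarrow> 0) cusp_filter"
    using filterlim_compose[OF _ filterlim_filtercomap, where f = Im] by (force simp: norm_ee)
qed

text \<open>The local parameter at infinity is \<open>ee (\<tau> / 2)\<close>, a square root of the
  nome, because the level 2 quotients contain eta at \<open>\<tau> / 2\<close>.\<close>

lemma filterlim_ee_half_cusp: "filterlim (\<lambda>\<tau>. ee (\<tau> / 2)) (at 0) cusp_filter"
  unfolding filterlim_at using ee_tendsto_0_cusp[of "1 / 2"] by simp

lemma weber1_expansion:
  "weber1 \<tau> = ee (- \<tau> / 6) * (euler_phi (ee (\<tau> / 2)) / euler_phi (ee (\<tau> / 2) ^ 2)) ^ 8"
proof -
  have "weber1 \<tau> = (ee (\<tau> / 24) / ee (\<tau> / 12)) ^ 4 * (euler_phi (ee (\<tau> / 2)) / euler_phi (ee \<tau>)) ^ 8"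
    by (simp add: weber1_def eta_sq_def power_mult_distrib power_divide flip: power_mult)
  also have "(ee (\<tau> / 24) / ee (\<tau> / 12)) ^ 4 = ee (- \<tau> / 6)"
    unfolding ee_diff[symmetric] ee_power by (rule arg_cong[of _ _ ee]) simp
  finally show ?thesis
    by (simp add: ee_power)
qed

lemma weber_expansion:
  assumes "Im \<tau> > 0"
  shows "weber \<tau> = ee (- \<tau> / 6) * (euler_phi (- ee (\<tau> / 2)) / euler_phi (ee (\<tau> / 2) ^ 2)) ^ 8"
proof -
  have h: "ee ((\<tau> + 1) / 2) = - ee (\<tau> / 2)"
    by (simp add: add_divide_distrib ee_add ee_half)
  have "ee (- 1 / 6) * weber \<tau> = ee (- (\<tau> + 1) / 6) *
      (euler_phi (- ee (\<tau> / 2)) / euler_phi (ee (\<tau> / 2) ^ 2)) ^ 8"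
    using weber_add_1(1)[OF assms] weber1_expansion[of "\<tau> + 1"] by (simp add: h)
  also have "ee (- (\<tau> + 1) / 6) = ee (- 1 / 6) * ee (- \<tau> / 6)"
    unfolding ee_add[symmetric] by (rule arg_cong[of _ _ ee]) (simp add: field_simps)
  finally show ?thesis
    by (simp only: mult.assoc mult_cancel_left ee_nonzero simp_thms)
qed

lemma weber2_expansion:
  "weber2 \<tau> = 16 * ee (\<tau> / 3) * (euler_phi (ee (\<tau> / 2) ^ 4) / euler_phi (ee (\<tau> / 2) ^ 2)) ^ 8"
proof -
  have "weber2 \<tau> = 16 * (ee (\<tau> / 6) / ee (\<tau> / 12)) ^ 4 * (euler_phi (ee (2 * \<tau>)) / euler_phi (ee \<tau>)) ^ 8"
    by (simp add: weber2_def eta_sq_def power_mult_distrib power_divide flip: power_mult)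
  also have "(ee (\<tau> / 6) / ee (\<tau> / 12)) ^ 4 = ee (\<tau> / 3)"
    unfolding ee_diff[symmetric] ee_power by (rule arg_cong[of _ _ ee]) simp
  finally show ?thesis
    by (simp add: ee_power)
qed

text \<open>This controls the difference of \<open>weber1\<close> and \<open>weber\<close>, whose
  expansions differ by the sign of the local parameter.\<close>

lemma has_field_derivative_symmetric_difference:
  fixes f :: "complex \<Rightarrow> complex"
  assumes "(f has_field_derivative d) (at 0)"
  shows "(\<lambda>h. (f h - f (- h)) / h) \<midarrow>0\<rightarrow> 2 * d"
proof -
  have "(\<lambda>h. (f h - f 0) / h) \<midarrow>0\<rightarrow> d"
    using assms by (simp add: DERIV_def)
  moreover from this have "(\<lambda>h. (f (- h) - f 0) / (- h)) \<midarrow>0\<rightarrow> d"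
    by (rule filterlim_compose) (auto simp: filterlim_at eventually_at_filter intro!: tendsto_eq_intros)
  ultimately have "(\<lambda>h. (f h - f 0) / h + (f (- h) - f 0) / (- h)) \<midarrow>0\<rightarrow> d + d"
    by (rule tendsto_add)
  then show ?thesis
    by (simp add: diff_divide_distrib)
qed

lemma holomorphic_euler_phi_power:
  assumes "n > 0"
  shows "(\<lambda>h. euler_phi (h ^ n)) holomorphic_on ball (0 :: complex) 1"
proof -
  have "(euler_phi \<circ> (\<lambda>h. h ^ n)) holomorphic_on ball (0 :: complex) 1"
    by (rule holomorphic_on_compose_gen[OF _ holomorphic_euler_phi])
       (use assms in \<open>auto intro!: holomorphic_intros simp: norm_power power_less_one_iff\<close>)
  then show ?thesis by (simp add: o_def)
qed

lemma tendsto_euler_phi_power: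
  assumes "n > 0"
  shows "(\<lambda>h. euler_phi (h ^ n :: complex)) \<midarrow>0\<rightarrow> 1"
proof -
  have "isCont (\<lambda>h. euler_phi (h ^ n :: complex)) 0"
    using holomorphic_on_imp_continuous_on[OF holomorphic_euler_phi_power[OF assms]]
    by (simp add: continuous_on_eq_continuous_at)
  moreover have "euler_phi (0 :: complex) = 1"
    by (simp add: euler_phi_def qpoch_def)
  ultimately show ?thesis
    using assms by (simp add: isCont_def power_0_left)
qed

text \<open>Jacobi's identity for theta constants, divided by the fourth power of eta.\<close>

lemma weber_eq_weber1_plus_weber2:
  assumes "Im \<tau> > 0"
  shows "weber \<tau> = weber1 \<tau> + weber2 \<tau>"
proof -
  define w where "w \<tau> = weber1 \<tau> + weber2 \<tau> - weber \<tau>" for \<tau>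
  \<comment> \<open>\<open>weber1\<close> and \<open>weber\<close> are
    \<open>ee (- \<tau> / 6)\<close> times \<open>A h\<close> and \<open>A (- h)\<close> with h =
    e(tau/2). Their difference gains a factor h, so \<open>w\<close> is
    \<open>ee (\<tau> / 3)\<close> times a function \<open>G\<close> with a finite limit at
    0.\<close>
  define A :: "complex \<Rightarrow> complex" where "A h = (euler_phi h / euler_phi (h ^ 2)) ^ 8" for h
  define G :: "complex \<Rightarrow> complex"
    where "G h = (A h - A (- h)) / h + 16 * (euler_phi (h ^ 4) / euler_phi (h ^ 2)) ^ 8" for h
  have "A holomorphic_on ball 0 1"
    unfolding A_def
    by (intro holomorphic_intros holomorphic_euler_phi holomorphic_euler_phi_power euler_phi_nonzero)
       (auto simp: norm_power power_less_one_iff)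
  then have "(A has_field_derivative deriv A 0) (at 0)"
    by (rule holomorphic_derivI) auto
  then have "G \<midarrow>0\<rightarrow> 2 * deriv A 0 + 16 * (1 / 1) ^ 8"
    unfolding G_def
    by (intro tendsto_intros has_field_derivative_symmetric_difference tendsto_euler_phi_power) auto
  then have "((\<lambda>\<tau>. G (ee (\<tau> / 2))) \<longlongrightarrow> 2 * deriv A 0 + 16 * (1 / 1) ^ 8) cusp_filter"
    by (rule filterlim_compose[OF _ filterlim_ee_half_cusp])
  with ee_tendsto_0_cusp[of "1 / 3"]
  have "((\<lambda>\<tau>. ee (of_real (1 / 3) * \<tau>) * G (ee (\<tau> / 2))) \<longlongrightarrow> 0 * (2 * deriv A 0 + 16 * (1 / 1) ^ 8)) cusp_filter"
    by (intro tendsto_mult) auto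
  moreover have "eventually (\<lambda>\<tau>. ee (of_real (1 / 3) * \<tau>) * G (ee (\<tau> / 2)) = w \<tau>) cusp_filter"
    using eventually_cusp_filter
  proof eventually_elim
    case (elim \<tau>)
    have "ee (\<tau> / 3) / ee (\<tau> / 2) = ee (- \<tau> / 6)"
      unfolding ee_diff[symmetric] by (rule arg_cong[of _ _ ee]) simp
    then have "ee (\<tau> / 3) * ((A (ee (\<tau> / 2)) - A (- ee (\<tau> / 2))) / ee (\<tau> / 2)) =
        ee (- \<tau> / 6) * (A (ee (\<tau> / 2)) - A (- ee (\<tau> / 2)))"
      by (metis times_divide_eq_left times_divide_eq_right)
    then show ?case
      unfolding w_def G_def weber1_expansion weber2_expansion weber_expansion[OF elim]
      by (simp add: A_def algebra_simps)
  qed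
  ultimately have cusp: "(w \<longlongrightarrow> 0) cusp_filter"
    by (simp add: tendsto_cong)
  have hol: "w holomorphic_on upper_half_plane"
    unfolding w_def weber_def weber1_def weber2_def
    by (intro holomorphic_intros holomorphic_eta_sq) (auto simp: eta_sq_nonzero)
  have "w \<tau> = 0"
  \<comment> \<open>In this centred strip below height 1/2 one has |tau|^2 \<le> 1/2, so the
    inversion at least doubles the imaginary part.\<close>
  proof (rule modular_family_eq_0[of "{()}" "\<lambda>_. w" "1 / 2" 2 "- 1 / 2"])
    show "norm (w (\<tau> + 1)) = norm (w \<tau>)" if "Im \<tau> > 0" for \<tau>
    proof -
      have "w (\<tau> + 1) = - ee (- 1 / 6) * w \<tau>"
        unfolding w_def weber_add_1[OF that] by (simp add: algebra_simps)
      then show ?thesis by (simp add: norm_mult norm_ee)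
    qed
    show "\<exists>\<tau>'. 2 * Im \<tau> \<le> Im \<tau>' \<and> (\<forall>i\<in>{()}. \<exists>j\<in>{()}. norm (w \<tau>) = norm (w \<tau>'))"
      if \<tau>: "- 1 / 2 \<le> Re \<tau>" "Re \<tau> \<le> - 1 / 2 + 1" "0 < Im \<tau>" "Im \<tau> < 1 / 2" for \<tau>
    proof (intro exI[of _ "- 1 / \<tau>"] conjI)
      have "(Re \<tau>)\<^sup>2 \<le> (1 / 2)\<^sup>2" "(Im \<tau>)\<^sup>2 \<le> (1 / 2)\<^sup>2"
        using \<tau> by (auto intro!: power2_le_iff_abs_le[THEN iffD2])
      then have "(norm \<tau>)\<^sup>2 \<le> 1 / 2"
        unfolding cmod_power2 by (simp add: power2_eq_square)
      moreover have "(norm \<tau>)\<^sup>2 > 0"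
        using \<tau>(3) by auto
      ultimately have "2 * Im \<tau> * (norm \<tau>)\<^sup>2 \<le> 2 * Im \<tau> * (1 / 2)"
        using \<tau>(3) by (intro mult_left_mono) auto
      then show "2 * Im \<tau> \<le> Im (- 1 / \<tau>)"
        unfolding Im_minus_inverse using \<open>(norm \<tau>)\<^sup>2 > 0\<close> by (simp add: field_simps)
      have "w (- 1 / \<tau>) = w \<tau>"
        unfolding w_def weber_inversion[OF \<tau>(3)] by simp
      then show "\<forall>i\<in>{()}. \<exists>j\<in>{()}. norm (w \<tau>) = norm (w (- 1 / \<tau>))"
        by simp
    qed
  qed (use hol cusp assms in auto)
  then show ?thesis by (simp add: w_def)
qed

text \<open>Expressing \<open>E\<^sub>4\<close> by eta quotients of level 2 makes the link to \<open>j_fun\<close> immediate, but hides the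
  modularity, which comes from Jacobi's identity.\<close>

definition eisenstein4 :: "complex \<Rightarrow> complex" where
  "eisenstein4 \<tau> = eta_sq (\<tau> / 2) ^ 8 / eta_sq \<tau> ^ 4 + 16 * eta_sq \<tau> ^ 8 / eta_sq (\<tau> / 2) ^ 4"

text \<open>By Jacobi's identity \<open>weber2 \<tau> * (weber1 \<tau> + weber2 \<tau>)\<close> is
  \<open>16 / weber1 \<tau>\<close>. The form x^2 + xy + y^2 is invariant under (x, y) -> (y, x) and
  (x, y) -> (x + y, -y), which are the effects of inversion and translation up to
  multipliers.\<close>

lemma eisenstein4_weber:
  assumes "Im \<tau> > 0"
  shows "eisenstein4 \<tau> = eta_sq \<tau> ^ 4 * (weber1 \<tau> ^ 2 + weber1 \<tau> * weber2 \<tau> + weber2 \<tau> ^ 2)"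
proof -
  note nz = eta_sq_nonzero[OF assms] eta_sq_nonzero[of "\<tau> / 2"]
  have "weber1 \<tau> ^ 2 + weber1 \<tau> * weber2 \<tau> + weber2 \<tau> ^ 2 = weber1 \<tau> ^ 2 + weber \<tau> * weber2 \<tau>"
    unfolding weber_eq_weber1_plus_weber2[OF assms] by (simp add: algebra_simps power2_eq_square)
  also have "weber \<tau> * weber2 \<tau> = 16 / weber1 \<tau>"
    using weber_product[OF assms] weber_nonzero[OF assms] by (simp add: field_simps)
  finally show ?thesis
    using nz assms by (simp add: eisenstein4_def weber1_def field_simps flip: power_add power_mult)
qed

lemma eisenstein4_add_1:
  assumes "Im \<tau> > 0"
  shows "eisenstein4 (\<tau> + 1) = eisenstein4 \<tau>"
proof -
  have e: "ee (1 / 12) ^ 4 * ee (- 1 / 6) ^ 2 = 1"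
    unfolding ee_power ee_add[symmetric] by simp
  have "eisenstein4 (\<tau> + 1) = (ee (1 / 12) * eta_sq \<tau>) ^ 4 * ((ee (- 1 / 6) * weber \<tau>) ^ 2 +
      (ee (- 1 / 6) * weber \<tau>) * (- ee (- 1 / 6) * weber2 \<tau>) + (- ee (- 1 / 6) * weber2 \<tau>) ^ 2)"
    using assms by (simp only: eisenstein4_weber weber_add_1 eta_sq_add_1 plus_complex.simps one_complex.simps add_0_right)
  also have "\<dots> = (ee (1 / 12) ^ 4 * ee (- 1 / 6) ^ 2) *
      (eta_sq \<tau> ^ 4 * (weber \<tau> ^ 2 - weber \<tau> * weber2 \<tau> + weber2 \<tau> ^ 2))"
    by (simp add: power_mult_distrib power2_eq_square algebra_simps)
  also have "\<dots> = eisenstein4 \<tau>"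
    unfolding e eisenstein4_weber[OF assms] weber_eq_weber1_plus_weber2[OF assms]
    by (simp add: power2_eq_square algebra_simps)
  finally show ?thesis .
qed

lemma eisenstein4_inversion:
  assumes "Im \<tau> > 0"
  shows "eisenstein4 (- 1 / \<tau>) = \<tau> ^ 4 * eisenstein4 \<tau>"
  unfolding eisenstein4_weber[OF assms] eisenstein4_weber[OF Im_minus_inverse_pos[OF assms]]
    weber_inversion[OF assms] eta_sq_inversion[OF assms]
  by (simp add: power_mult_distrib algebra_simps)

section \<open>The level 5 identity\<close>

text \<open>The expansion 1 + a h + b h^2 + o(h^2) as a punctured limit. Few coefficients are
  needed, and no infinite product has to be differentiated.\<close>

definition jet :: "(complex \<Rightarrow> complex) \<Rightarrow> complex \<Rightarrow> complex \<Rightarrow> bool" where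
  "jet f a b \<longleftrightarrow> (\<lambda>h. (f h - 1 - a * h) / h\<^sup>2) \<midarrow>0\<rightarrow> b"

lemma jet_tendsto_1:
  assumes "jet f a b"
  shows "f \<midarrow>0\<rightarrow> 1"
proof -
  have "(\<lambda>h. (f h - 1 - a * h) / h\<^sup>2 * h\<^sup>2 + 1 + a * h) \<midarrow>0\<rightarrow> b * 0\<^sup>2 + 1 + a * 0"
    using assms unfolding jet_def by (intro tendsto_intros)
  moreover have "eventually (\<lambda>h. (f h - 1 - a * h) / h\<^sup>2 * h\<^sup>2 + 1 + a * h = f h) (at 0)"
    by (auto simp: eventually_at_filter)
  ultimately show ?thesis
    by (simp add: tendsto_cong)
qed

lemma jet_deriv:
  assumes "jet f a b"
  shows "(\<lambda>h. (f h - 1) / h) \<midarrow>0\<rightarrow> a"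
proof -
  have "(\<lambda>h. (f h - 1 - a * h) / h\<^sup>2 * h + a) \<midarrow>0\<rightarrow> b * 0 + a"
    using assms unfolding jet_def by (intro tendsto_intros)
  moreover have "eventually (\<lambda>h. (f h - 1 - a * h) / h\<^sup>2 * h + a = (f h - 1) / h) (at 0)"
    by (auto simp: eventually_at_filter field_simps power2_eq_square)
  ultimately show ?thesis
    by (simp add: tendsto_cong)
qed

lemma jet_mult:
  assumes "jet f a b" "jet g a' b'"
  shows "jet (\<lambda>h. f h * g h) (a + a') (b + b' + a * a')"
proof -
  \<comment> \<open>The remainder of the product consists of the remainder of \<open>f\<close> times
    \<open>g\<close>, the linear part of \<open>f\<close> times the remainder of \<open>g\<close>,
    and the cross term.\<close>
  have "(\<lambda>h. (f h - 1 - a * h) / h\<^sup>2 * g h + (1 + a * h) * ((g h - 1 - a' * h) / h\<^sup>2) + a * a')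
      \<midarrow>0\<rightarrow> b * 1 + (1 + a * 0) * b' + a * a'"
    using assms jet_tendsto_1[OF assms(2)] unfolding jet_def by (intro tendsto_intros)
  moreover have "eventually (\<lambda>h. (f h - 1 - a * h) / h\<^sup>2 * g h + (1 + a * h) * ((g h - 1 - a' * h) / h\<^sup>2) + a * a'
      = (f h * g h - 1 - (a + a') * h) / h\<^sup>2) (at 0)"
    by (auto simp: eventually_at_filter field_simps power2_eq_square)
  ultimately show ?thesis
    by (simp add: tendsto_cong jet_def)
qed

lemma jet_inverse:
  assumes "jet f a b"
  shows "jet (\<lambda>h. inverse (f h)) (- a) (a\<^sup>2 - b)"
proof -
  note lim = jet_tendsto_1[OF assms]
  \<comment> \<open>The numerator is 1 - f + a h f, divided by h^2, with f written as 1 + a h plus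
    its remainder.\<close>
  have "(\<lambda>h. (a\<^sup>2 - (f h - 1 - a * h) / h\<^sup>2 + a * h * ((f h - 1 - a * h) / h\<^sup>2)) / f h)
      \<midarrow>0\<rightarrow> (a\<^sup>2 - b + a * 0 * b) / 1"
    using assms lim unfolding jet_def by (intro tendsto_intros) auto
  moreover have "eventually (\<lambda>h. (a\<^sup>2 - (f h - 1 - a * h) / h\<^sup>2 + a * h * ((f h - 1 - a * h) / h\<^sup>2)) / f h
      = (inverse (f h) - 1 - - a * h) / h\<^sup>2) (at 0)"
  proof -
    have "eventually (\<lambda>h. f h \<noteq> 0) (at 0)"
      by (rule tendsto_imp_eventually_ne[OF lim]) simp
    moreover have "eventually (\<lambda>h::complex. h \<noteq> 0) (at 0)"
      by (simp add: eventually_at_filter)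
    ultimately show ?thesis
      by eventually_elim (simp add: field_simps power2_eq_square)
  qed
  ultimately show ?thesis
    by (simp add: tendsto_cong jet_def)
qed

lemma jet_const: "jet (\<lambda>_. 1) 0 0"
  by (simp add: jet_def)

lemma jet_power:
  assumes "jet f a b"
  shows "jet (\<lambda>h. f h ^ n) (of_nat n * a) (of_nat n * b + of_nat (n choose 2) * a\<^sup>2)"
proof (induction n)
  case 0
  then show ?case by (simp add: jet_const numeral_2_eq_2)
next
  case (Suc n)
  have "jet (\<lambda>h. f h * f h ^ n) (a + of_nat n * a) (b + (of_nat n * b + of_nat (n choose 2) * a\<^sup>2) + a * (of_nat n * a))"
    by (rule jet_mult[OF assms Suc])
  then show ?case
    by (simp add: numeral_2_eq_2 algebra_simps)
qed

lemma jet_add_linear: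
  assumes "jet f a b" "jet g a' b'"
  shows "jet (\<lambda>h. f h + c * h * g h) (a + c) (b + c * a')"
proof -
  have "(\<lambda>h. (f h - 1 - a * h) / h\<^sup>2 + c * ((g h - 1) / h)) \<midarrow>0\<rightarrow> b + c * a'"
    using assms(1) jet_deriv[OF assms(2)] unfolding jet_def by (intro tendsto_intros)
  moreover have "eventually (\<lambda>h. (f h - 1 - a * h) / h\<^sup>2 + c * ((g h - 1) / h)
      = (f h + c * h * g h - 1 - (a + c) * h) / h\<^sup>2) (at 0)"
    by (auto simp: eventually_at_filter field_simps power2_eq_square)
  ultimately show ?thesis
    by (simp add: tendsto_cong jet_def)
qed

text \<open>The linear term of \<open>f\<close> moves to order \<open>n\<close>, which second order
  sees only for \<open>n = 2\<close>.\<close>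

lemma jet_compose_power:
  assumes "jet f a b" "n \<ge> 2"
  shows "jet (\<lambda>h. f (h ^ n)) 0 (if n = 2 then a else 0)"
proof -
  have "filterlim (\<lambda>h::complex. h ^ n) (at 0) (at 0)"
    unfolding filterlim_at using assms(2) by (auto simp: eventually_at_filter intro!: tendsto_eq_intros)
  then have "(\<lambda>h. (f (h ^ n) - 1) / h ^ n) \<midarrow>0\<rightarrow> a"
    by (rule filterlim_compose[OF jet_deriv[OF assms(1)]])
  then have "(\<lambda>h. (f (h ^ n) - 1) / h ^ n * h ^ (n - 2)) \<midarrow>0\<rightarrow> a * 0 ^ (n - 2)"
    by (intro tendsto_intros)
  moreover have "eventually (\<lambda>h. (f (h ^ n) - 1) / h ^ n * h ^ (n - 2) = (f (h ^ n) - 1 - 0 * h) / h\<^sup>2) (at 0)"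
  proof -
    obtain m where "n = m + 2" using assms(2) by (metis add.commute le_iff_add)
    then show ?thesis
      by (auto simp: eventually_at_filter power_add power2_eq_square)
  qed
  ultimately show ?thesis
    by (cases "n = 2") (use assms(2) in \<open>simp_all add: tendsto_cong jet_def power_0_left\<close>)
qed

lemma jet_euler_phi: "jet euler_phi (-1) (-1)"
proof -
  \<comment> \<open>\<open>R\<close> collects Euler's factors from \<open>1 - h ^ 3\<close> on;
    being 1 + O(h^3), it leaves the coefficients to the first two factors.\<close>
  define R where "R h = qpoch (h ^ 3) h" for h :: complex
  have R: "jet R 0 0"
    unfolding jet_def
  proof (rule Lim_null_comparison)
    show "eventually (\<lambda>h. norm ((R h - 1 - 0 * h) / h\<^sup>2) \<le> (exp (norm h ^ 3 / (1 - norm h)) - 1) / (norm h)\<^sup>2) (at 0)"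
    proof -
      have "eventually (\<lambda>h::complex. h \<in> ball 0 1) (at 0)"
        by (intro eventually_at_in_open') auto
      then show ?thesis
      proof eventually_elim
        case (elim h)
        then show ?case
          using norm_qpoch_minus_1_le[of h "h ^ 3"]
          by (auto simp: R_def norm_divide norm_power intro!: divide_right_mono)
      qed
    qed
    have "((\<lambda>x::real. (exp (x ^ 3 / (1 - x)) - 1) / x\<^sup>2) \<longlongrightarrow> 0) (at_right 0)"
      by real_asymp
    moreover have "filterlim (\<lambda>h::complex. norm h) (at_right 0) (at 0)"
      unfolding filterlim_at by (auto simp: eventually_at_filter intro!: tendsto_eq_intros)
    ultimately show "(\<lambda>h::complex. (exp (norm h ^ 3 / (1 - norm h)) - 1) / (norm h)\<^sup>2) \<midarrow>0\<rightarrow> 0"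
      by (rule filterlim_compose)
  qed
  have "jet (\<lambda>h. 1 - h) (-1) 0" "jet (\<lambda>h. 1 - h\<^sup>2) 0 (-1)"
    by (auto simp: jet_def intro!: tendsto_eventually simp: eventually_at_filter)
  from jet_mult[OF jet_mult[OF this] R]
  have J: "jet (\<lambda>h. (1 - h) * (1 - h\<^sup>2) * R h) (-1) (-1)"
    by simp
  have eq: "(1 - h) * (1 - h\<^sup>2) * R h = euler_phi h" if "h \<in> ball 0 1" for h
    using qpoch_rec[of h h] qpoch_rec[of h "h\<^sup>2"] that
    by (simp add: euler_phi_def R_def power2_eq_square power3_eq_cube mult.assoc)
  have "eventually (\<lambda>h::complex. h \<in> ball 0 1) (at 0)"
    by (intro eventually_at_in_open') auto
  then have "eventually (\<lambda>h. ((1 - h) * (1 - h\<^sup>2) * R h - 1 - (-1) * h) / h\<^sup>2 = (euler_phi h - 1 - (-1) * h) / h\<^sup>2) (at 0)"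
    by eventually_elim (simp only: eq)
  then show ?thesis
    unfolding jet_def by (rule Lim_transform_eventually[OF J[unfolded jet_def]])
qed

definition eisenstein4_h :: "complex \<Rightarrow> complex" where
  "eisenstein4_h h = euler_phi h ^ 16 / euler_phi (h ^ 2) ^ 8 + 16 * h * (euler_phi (h ^ 2) ^ 16 / euler_phi h ^ 8)"

lemma eisenstein4_expansion: "eisenstein4 \<tau> = eisenstein4_h (ee (\<tau> / 2))"
proof -
  have a: "ee (\<tau> / 24) ^ 8 / ee (\<tau> / 12) ^ 4 = 1"
    unfolding ee_power ee_diff[symmetric] by simp
  have b: "ee (\<tau> / 12) ^ 8 / ee (\<tau> / 24) ^ 4 = ee (\<tau> / 2)"
    unfolding ee_power ee_diff[symmetric] by (rule arg_cong[of _ _ ee]) simp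
  have "eisenstein4 \<tau> =
      (ee (\<tau> / 24) ^ 8 / ee (\<tau> / 12) ^ 4) * (euler_phi (ee (\<tau> / 2)) ^ 16 / euler_phi (ee \<tau>) ^ 8) +
      16 * (ee (\<tau> / 12) ^ 8 / ee (\<tau> / 24) ^ 4) * (euler_phi (ee \<tau>) ^ 16 / euler_phi (ee (\<tau> / 2)) ^ 8)"
    by (simp add: eisenstein4_def eta_sq_def power_mult_distrib flip: power_mult)
  then show ?thesis
    unfolding a b eisenstein4_h_def by (simp add: ee_power)
qed

text \<open>Since h^2 is the nome q, this is E_4 = 1 + 240 q + ...; the linear terms -16 h and 16 h
  of the two eta quotients cancel.\<close>

lemma jet_eisenstein4_h: "jet eisenstein4_h 0 240"
proof -
  note P = jet_euler_phi jet_compose_power[OF jet_euler_phi, of 2]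
  have "jet (\<lambda>h. euler_phi h ^ 16 * inverse (euler_phi (h ^ 2) ^ 8)) (-16) 112"
    using jet_mult[OF jet_power[OF P(1), of 16] jet_inverse[OF jet_power[OF P(2), of 8]]]
    by (simp add: choose_two)
  moreover have "jet (\<lambda>h. euler_phi (h ^ 2) ^ 16 * inverse (euler_phi h ^ 8)) 8 28"
    using jet_mult[OF jet_power[OF P(2), of 16] jet_inverse[OF jet_power[OF P(1), of 8]]]
    by (simp add: choose_two)
  ultimately have "jet (\<lambda>h. euler_phi h ^ 16 * inverse (euler_phi (h ^ 2) ^ 8) +
      16 * h * (euler_phi (h ^ 2) ^ 16 * inverse (euler_phi h ^ 8))) (-16 + 16) (112 + 16 * 8)"
    by (rule jet_add_linear)
  then show ?thesis
    by (simp add: eisenstein4_h_def[abs_def] divide_inverse)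
qed

text \<open>The matrix with rows (2, -1) and (5, -2) has determinant 1 and trace 0: an elliptic
  element of Gamma_0(5) fixing (2 + i)/5. It is written as a word in translation and inversion;
  \<open>n\<close>, \<open>\<kappa>\<close> and \<open>\<omega>\<close> allow for both eta and
  E_4.\<close>

lemma modular_elliptic_element:
  fixes f :: "complex \<Rightarrow> complex"
  assumes shift: "\<And>\<tau>. Im \<tau> > 0 \<Longrightarrow> f (\<tau> + 1) = \<omega> * f \<tau>" and "\<omega> \<noteq> 0"
    and inv: "\<And>\<tau>. Im \<tau> > 0 \<Longrightarrow> f (- 1 / \<tau>) = (\<kappa> * \<tau>) ^ n * f \<tau>"
    and im: "Im \<tau> > 0"
  shows "f ((2 * \<tau> - 1) / (5 * \<tau> - 2)) = (\<kappa> ^ 3 * (2 - 5 * \<tau>)) ^ n * f \<tau>"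
    and "f (5 * ((2 * \<tau> - 1) / (5 * \<tau> - 2))) = (\<kappa> * (5 * \<tau> - 2)) ^ n * f (5 * \<tau>)"
proof -
  have plus2: "f (\<tau> + 2) = \<omega>\<^sup>2 * f \<tau>" if "Im \<tau> > 0" for \<tau>
    using shift[of \<tau>] shift[of "\<tau> + 1"] that by (simp add: add.assoc power2_eq_square)
  have minus2: "f (\<tau> - 2) = f \<tau> / \<omega>\<^sup>2" if "Im \<tau> > 0" for \<tau>
    using plus2[of "\<tau> - 2"] that \<open>\<omega> \<noteq> 0\<close> by simp
  have nz: "\<tau> \<noteq> 0" "2 * \<tau> - 1 \<noteq> 0" "5 * \<tau> - 2 \<noteq> 0" "2 - 5 * \<tau> \<noteq> 0"
    using im by (auto simp: complex_eq_iff)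
  \<comment> \<open>The word passes from \<open>\<tau>\<close> through \<open>\<sigma>1\<close> and
    \<open>\<sigma>3\<close> to \<open>- 1 / \<sigma>3\<close>. The translations by 2 and -2 cancel
    in \<open>\<omega>\<close>, and the inversion factors telescope to
    \<open>2 - 5 * \<tau>\<close>.\<close>
  define \<sigma>1 where "\<sigma>1 = - 1 / \<tau> + 2"
  define \<sigma>3 where "\<sigma>3 = - 1 / \<sigma>1 - 2"
  have im1: "Im \<sigma>1 > 0"
    using Im_minus_inverse_pos[OF im] by (simp add: \<sigma>1_def)
  have im3: "Im \<sigma>3 > 0"
    using Im_minus_inverse_pos[OF im1] by (simp add: \<sigma>3_def)
  have \<sigma>1: "\<sigma>1 = (2 * \<tau> - 1) / \<tau>"
    using nz by (simp add: \<sigma>1_def field_simps)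
  have \<sigma>3: "\<sigma>3 = (2 - 5 * \<tau>) / (2 * \<tau> - 1)"
    using nz unfolding \<sigma>3_def \<sigma>1 by (simp add: divide_simps)
  have \<gamma>: "(2 * \<tau> - 1) / (5 * \<tau> - 2) = - 1 / \<sigma>3"
    using nz unfolding \<sigma>3 by (simp add: divide_simps) (simp add: algebra_simps)
  have "f (- 1 / \<sigma>3) = (\<kappa> * \<sigma>3) ^ n * f (- 1 / \<sigma>1 - 2)"
    using inv[OF im3] by (simp add: \<sigma>3_def)
  also have "f (- 1 / \<sigma>1 - 2) = (\<kappa> * \<sigma>1) ^ n * f (- 1 / \<tau> + 2) / \<omega>\<^sup>2"
    using minus2[OF Im_minus_inverse_pos[OF im1]] inv[OF im1] by (simp add: \<sigma>1_def)
  also have "f (- 1 / \<tau> + 2) = \<omega>\<^sup>2 * ((\<kappa> * \<tau>) ^ n * f \<tau>)"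
    using plus2[OF Im_minus_inverse_pos[OF im]] inv[OF im] by simp
  also have "(\<kappa> * \<sigma>3) ^ n * ((\<kappa> * \<sigma>1) ^ n * (\<omega>\<^sup>2 * ((\<kappa> * \<tau>) ^ n * f \<tau>)) / \<omega>\<^sup>2) =
      (\<kappa> ^ 3 * (\<sigma>3 * \<sigma>1 * \<tau>)) ^ n * f \<tau>"
    using \<open>\<omega> \<noteq> 0\<close> by (simp add: power_mult_distrib power3_eq_cube)
  also have "\<sigma>3 * \<sigma>1 * \<tau> = 2 - 5 * \<tau>"
    using nz by (simp add: \<sigma>3 \<sigma>1)
  finally show "f ((2 * \<tau> - 1) / (5 * \<tau> - 2)) = (\<kappa> ^ 3 * (2 - 5 * \<tau>)) ^ n * f \<tau>"
    by (simp only: \<gamma>)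
  have im5: "Im (5 * \<tau>) > 0" "Im (5 * \<tau> - 2) > 0"
    using im by simp_all
  \<comment> \<open>Five times the image needs only one inversion, applied to
    \<open>5 * \<tau> - 2\<close>.\<close>
  have "5 * ((2 * \<tau> - 1) / (5 * \<tau> - 2)) = - 1 / (5 * \<tau> - 2) + 2"
    using nz by (simp add: divide_simps)
  then show "f (5 * ((2 * \<tau> - 1) / (5 * \<tau> - 2))) = (\<kappa> * (5 * \<tau> - 2)) ^ n * f (5 * \<tau>)"
    using plus2[OF Im_minus_inverse_pos[OF im5(2)]] inv[OF im5(2)] minus2[OF im5(1)] \<open>\<omega> \<noteq> 0\<close>
    by simp
qed

lemma eta_sq_elliptic_element:
  assumes "Im \<tau> > 0"
  shows "eta_sq ((2 * \<tau> - 1) / (5 * \<tau> - 2)) = - \<i> * (5 * \<tau> - 2) * eta_sq \<tau>"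
    and "eta_sq (5 * ((2 * \<tau> - 1) / (5 * \<tau> - 2))) = - \<i> * (5 * \<tau> - 2) * eta_sq (5 * \<tau>)"
proof -
  have inv: "eta_sq (- 1 / \<sigma>) = (- \<i> * \<sigma>) ^ 1 * eta_sq \<sigma>" if "Im \<sigma> > 0" for \<sigma>
    using eta_sq_inversion[OF that] by simp
  have i: "(- \<i>) ^ 3 * (2 - 5 * \<tau>) = - \<i> * (5 * \<tau> - 2)"
    by (simp add: power3_eq_cube algebra_simps)
  show "eta_sq ((2 * \<tau> - 1) / (5 * \<tau> - 2)) = - \<i> * (5 * \<tau> - 2) * eta_sq \<tau>"
    using modular_elliptic_element(1)[of eta_sq, OF eta_sq_add_1 ee_nonzero inv assms]
    unfolding i power_one_right .
  show "eta_sq (5 * ((2 * \<tau> - 1) / (5 * \<tau> - 2))) = - \<i> * (5 * \<tau> - 2) * eta_sq (5 * \<tau>)"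
    using modular_elliptic_element(2)[of eta_sq, OF eta_sq_add_1 ee_nonzero inv assms]
    unfolding power_one_right .
qed

lemma eisenstein4_elliptic_element:
  assumes "Im \<tau> > 0"
  shows "eisenstein4 ((2 * \<tau> - 1) / (5 * \<tau> - 2)) = (5 * \<tau> - 2) ^ 4 * eisenstein4 \<tau>"
    and "eisenstein4 (5 * ((2 * \<tau> - 1) / (5 * \<tau> - 2))) = (5 * \<tau> - 2) ^ 4 * eisenstein4 (5 * \<tau>)"
proof -
  have shift: "eisenstein4 (\<sigma> + 1) = 1 * eisenstein4 \<sigma>" if "Im \<sigma> > 0" for \<sigma>
    using eisenstein4_add_1[OF that] by simp
  have inv: "eisenstein4 (- 1 / \<sigma>) = (1 * \<sigma>) ^ 4 * eisenstein4 \<sigma>" if "Im \<sigma> > 0" for \<sigma>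
    using eisenstein4_inversion[OF that] by simp
  have "(2 - 5 * \<tau>) ^ 4 = (5 * \<tau> - 2) ^ 4"
    using power_minus_even[of 4 "5 * \<tau> - 2"] by simp
  then show "eisenstein4 ((2 * \<tau> - 1) / (5 * \<tau> - 2)) = (5 * \<tau> - 2) ^ 4 * eisenstein4 \<tau>"
    using modular_elliptic_element(1)[of eisenstein4, OF shift one_neq_zero inv assms] by simp
  show "eisenstein4 (5 * ((2 * \<tau> - 1) / (5 * \<tau> - 2))) = (5 * \<tau> - 2) ^ 4 * eisenstein4 (5 * \<tau>)"
    using modular_elliptic_element(2)[of eisenstein4, OF shift one_neq_zero inv assms] by simp
qed

text \<open>The Hauptmodul (eta(tau) / eta(5 tau))^6 of Gamma_0(5).\<close>

definition eta_quot5 :: "complex \<Rightarrow> complex" where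
  "eta_quot5 \<tau> = (eta_sq \<tau> / eta_sq (5 * \<tau>)) ^ 3"

lemma eta_quot5_nonzero: "Im \<tau> > 0 \<Longrightarrow> eta_quot5 \<tau> \<noteq> 0"
  using eta_sq_nonzero[of \<tau>] eta_sq_nonzero[of "5 * \<tau>"] by (simp add: eta_quot5_def)

text \<open>The family \<open>level5 b\<close> measures the defect of the identities expressing the Eisenstein series at
  \<open>\<tau>\<close> and at \<open>5 \<tau>\<close>; the Fricke involution interchanges its two members.\<close>

definition level5 :: "bool \<Rightarrow> complex \<Rightarrow> complex" where
  "level5 b \<tau> = (if b
     then eisenstein4 \<tau> / (eta_sq \<tau> * eta_sq (5 * \<tau>)) ^ 2 - (eta_quot5 \<tau> + 250 + 3125 / eta_quot5 \<tau>)
     else 25 * (eisenstein4 (5 * \<tau>) / (eta_sq \<tau> * eta_sq (5 * \<tau>)) ^ 2 -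
       (eta_quot5 \<tau> + 10 + 5 / eta_quot5 \<tau>)))"

text \<open>The product of the two eta squares changes sign, which its square removes; their
  quotient acquires e(-1/3), which the cube removes.\<close>

lemma level5_add_1:
  assumes "Im \<tau> > 0"
  shows "level5 b (\<tau> + 1) = level5 b \<tau>"
proof -
  have five: "f (5 * (\<tau> + 1)) = \<omega> ^ 5 * f (5 * \<tau>)"
    if shift: "\<And>\<sigma>. Im \<sigma> > 0 \<Longrightarrow> f (\<sigma> + 1) = \<omega> * f \<sigma>" for f :: "complex \<Rightarrow> complex" and \<omega>
  proof -
    have "f (5 * \<tau> + of_nat n) = \<omega> ^ n * f (5 * \<tau>)" for n
      using assms shift[of "5 * \<tau> + of_nat k" for k]
      by (induction n) (simp_all add: add.assoc[symmetric] add.commute[of 1])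
    from this[of 5] show ?thesis by (simp add: distrib_left)
  qed
  have g: "eta_sq (5 * (\<tau> + 1)) = ee (5 / 12) * eta_sq (5 * \<tau>)"
    using five[of eta_sq, OF eta_sq_add_1] by (simp add: ee_power)
  have E: "eisenstein4 (5 * (\<tau> + 1)) = eisenstein4 (5 * \<tau>)"
    using five[of eisenstein4 1] eisenstein4_add_1 by simp
  have a: "ee (1 / 12) * ee (5 / 12) = - 1"
    unfolding ee_add[symmetric] by (simp add: ee_half)
  have b: "(ee (1 / 12) / ee (5 / 12)) ^ 3 = 1"
    using ee_minus[of 1] unfolding ee_diff[symmetric] ee_power by simp
  have c: "(eta_sq (\<tau> + 1) * eta_sq (5 * (\<tau> + 1))) ^ 2 = (eta_sq \<tau> * eta_sq (5 * \<tau>)) ^ 2"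
  proof -
    have "eta_sq (\<tau> + 1) * eta_sq (5 * (\<tau> + 1)) = (ee (1 / 12) * ee (5 / 12)) * (eta_sq \<tau> * eta_sq (5 * \<tau>))"
      unfolding g eta_sq_add_1 by simp
    then show ?thesis unfolding a by simp
  qed
  have d: "eta_quot5 (\<tau> + 1) = eta_quot5 \<tau>"
  proof -
    have "eta_quot5 (\<tau> + 1) = (ee (1 / 12) / ee (5 / 12)) ^ 3 * eta_quot5 \<tau>"
      unfolding eta_quot5_def g eta_sq_add_1 by (simp add: power_divide power_mult_distrib)
    then show ?thesis unfolding b by simp
  qed
  show ?thesis
    unfolding level5_def c d E eisenstein4_add_1[OF assms] by (rule refl)
qed

text \<open>The Hauptmodul t goes to 125/t, and t + 250 + 3125/t becomes 25 (t + 10 + 5/t). The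
  Eisenstein term contributes 625/25, whence the factor 25 in \<open>level5\<close>.\<close>

lemma level5_fricke:
  assumes "Im \<tau> > 0"
  shows "level5 b (- 1 / (5 * \<tau>)) = level5 (\<not> b) \<tau>"
proof -
  have im5: "Im (5 * \<tau>) > 0" using assms by simp
  have t0: "\<tau> \<noteq> 0" using assms by auto
  note nz = eta_sq_nonzero[OF assms] eta_sq_nonzero[OF im5] eta_quot5_nonzero[OF assms]
  have five: "5 * (- 1 / (5 * \<tau>)) = - 1 / \<tau>" by simp
  have den: "(eta_sq (- 1 / (5 * \<tau>)) * eta_sq (5 * (- 1 / (5 * \<tau>)))) ^ 2 =
      25 * \<tau> ^ 4 * (eta_sq \<tau> * eta_sq (5 * \<tau>)) ^ 2"
    unfolding five eta_sq_inversion[OF assms] eta_sq_inversion[OF im5]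
    by (simp add: power_mult_distrib)
  have quot: "eta_quot5 (- 1 / (5 * \<tau>)) = 125 / eta_quot5 \<tau>"
    unfolding eta_quot5_def five eta_sq_inversion[OF assms] eta_sq_inversion[OF im5]
    using t0 by (simp add: power_mult_distrib power_divide)
  have E: "eisenstein4 (- 1 / (5 * \<tau>)) = 625 * \<tau> ^ 4 * eisenstein4 (5 * \<tau>)"
    unfolding eisenstein4_inversion[OF im5] by (simp add: power_mult_distrib)
  show ?thesis
    unfolding level5_def den quot E unfolding five eisenstein4_inversion[OF assms]
    using nz t0 by (cases b) (simp_all add: field_simps)
qed

lemma level5_elliptic_element:
  assumes "Im \<tau> > 0"
  shows "level5 b ((2 * \<tau> - 1) / (5 * \<tau> - 2)) = level5 b \<tau>"
proof -
  have u: "5 * \<tau> - 2 \<noteq> 0" using assms by (auto simp: complex_eq_iff)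
  have mult: "(- \<i> * u * x * (- \<i> * u * y))\<^sup>2 = u ^ 4 * (x * y)\<^sup>2" for u x y
    by (simp add: power_mult_distrib)
  have quot: "eta_quot5 ((2 * \<tau> - 1) / (5 * \<tau> - 2)) = eta_quot5 \<tau>"
    unfolding eta_quot5_def eta_sq_elliptic_element[OF assms] using u by simp
  show ?thesis
    unfolding level5_def quot eisenstein4_elliptic_element[OF assms] eta_sq_elliptic_element[OF assms] mult
    using u by simp
qed

text \<open>The poles 1/q of the two sides cancel, and the constants 250 and 10 are the ones that
  make the constant terms agree.\<close>

lemma level5_tendsto_0: "(level5 b \<longlongrightarrow> 0) cusp_filter"
proof -
  define h where "h \<tau> = ee (\<tau> / 2)" for \<tau>
  define D :: "complex \<Rightarrow> complex" where "D h = (euler_phi (h ^ 2) * euler_phi (h ^ 10)) ^ 4" for h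
  define B :: "complex \<Rightarrow> complex" where "B h = (euler_phi (h ^ 2) * inverse (euler_phi (h ^ 10))) ^ 6" for h
  define E :: "complex \<Rightarrow> complex" where "E h = (if b then eisenstein4_h h else eisenstein4_h (h ^ 5))" for h
  define m k :: complex where "m = (if b then 250 else 10)" and "k = (if b then 3125 else 5)"
  define G where "G h = (E h * inverse (D h) - B h) / h\<^sup>2 - (m + k * h\<^sup>2 / B h)" for h
  have h2: "ee \<tau> = h \<tau> ^ 2" "ee (5 * \<tau>) = h \<tau> ^ 10" "ee (5 * \<tau> / 2) = h \<tau> ^ 5" for \<tau>
    by (simp_all add: h_def ee_power)
  have level5_eq: "level5 b \<tau> = (if b then 1 else 25) * G (h \<tau>)" for \<tau>
  proof -
    have E: "(if b then eisenstein4 \<tau> else eisenstein4 (5 * \<tau>)) = E (h \<tau>)"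
      unfolding eisenstein4_expansion E_def h2(3)[of \<tau>] by (simp add: h_def)
    have "ee (\<tau> / 12) * ee (5 * \<tau> / 12) = h \<tau>"
      unfolding ee_add[symmetric] h_def by (rule arg_cong[of _ _ ee]) simp
    moreover have "(eta_sq \<tau> * eta_sq (5 * \<tau>)) ^ 2 = (ee (\<tau> / 12) * ee (5 * \<tau> / 12))\<^sup>2 * D (h \<tau>)"
      unfolding eta_sq_def D_def h2(1,2)[of \<tau>] by (simp add: power_mult_distrib mult_ac flip: power_mult)
    ultimately have den: "(eta_sq \<tau> * eta_sq (5 * \<tau>)) ^ 2 = (h \<tau>)\<^sup>2 * D (h \<tau>)"
      by (simp only:)
    have "(ee (\<tau> / 12) / ee (5 * \<tau> / 12)) ^ 3 = 1 / (h \<tau>)\<^sup>2"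
      unfolding ee_diff[symmetric] ee_power h_def ee_minus[symmetric]
      by (rule arg_cong[of _ _ ee]) simp
    moreover have "eta_quot5 \<tau> = (ee (\<tau> / 12) / ee (5 * \<tau> / 12)) ^ 3 * B (h \<tau>)"
      unfolding eta_quot5_def eta_sq_def B_def h2(1,2)[of \<tau>]
      by (simp add: power_mult_distrib power_divide field_simps flip: power_mult)
    ultimately have quot: "eta_quot5 \<tau> = B (h \<tau>) / (h \<tau>)\<^sup>2"
      by simp
    show ?thesis
      using E unfolding level5_def den quot G_def m_def k_def
      by (cases b) (simp_all add: divide_inverse algebra_simps)
  qed
  have P: "jet (\<lambda>h. euler_phi (h ^ 2)) 0 (- 1)" "jet (\<lambda>h. euler_phi (h ^ 10)) 0 0"
    using jet_compose_power[OF jet_euler_phi, of 2] jet_compose_power[OF jet_euler_phi, of 10] by simp_all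
  have jetD: "jet D 0 (- 4)"
    using jet_power[OF jet_mult[OF P], of 4] by (simp add: D_def[abs_def])
  have jetB: "jet B 0 (- 6)"
    using jet_power[OF jet_mult[OF P(1) jet_inverse[OF P(2)]], of 6] by (simp add: B_def[abs_def])
  have jetE: "jet E 0 (if b then 240 else 0)"
    using jet_eisenstein4_h jet_compose_power[OF jet_eisenstein4_h, of 5] by (simp add: E_def[abs_def])
  \<comment> \<open>The coefficient is 240 + 4 or 0 + 4; subtracting the -6 of \<open>B\<close>
    gives 250 or 10.\<close>
  have jetED: "jet (\<lambda>h. E h * inverse (D h)) 0 (m - 6)"
    using jet_mult[OF jetE jet_inverse[OF jetD]] by (cases b) (simp_all add: m_def)
  have "(\<lambda>h. (E h * inverse (D h) - 1 - 0 * h) / h\<^sup>2 - (B h - 1 - 0 * h) / h\<^sup>2 - (m + k * h\<^sup>2 / B h))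
      \<midarrow>0\<rightarrow> (m - 6) - (- 6) - (m + k * 0\<^sup>2 / 1)"
    using jetED jetB jet_tendsto_1[OF jetB] unfolding jet_def by (intro tendsto_intros) auto
  then have "G \<midarrow>0\<rightarrow> 0"
    by (simp add: G_def[abs_def] diff_divide_distrib)
  then have "((\<lambda>\<tau>. (if b then 1 else 25) * G (h \<tau>)) \<longlongrightarrow> (if b then 1 else 25) * 0) cusp_filter"
    unfolding h_def by (intro tendsto_mult tendsto_const filterlim_compose[OF _ filterlim_ee_half_cusp])
  then show ?thesis
    by (simp add: level5_eq[abs_def])
qed

text \<open>Below height 1/20 two maps cover the strip: up to real part 21/50 the Fricke involution,
  where 5 |tau|^2 \<le> 9/10, and from there to 29/50 the elliptic element, where |5 tau - 2|^2
  \<le> 9/10. Either raises the height by a factor of at least 10/9.\<close>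

lemma level5_eq_0:
  assumes "Im \<tau> > 0"
  shows "level5 b \<tau> = 0"
proof (rule modular_family_eq_0[of UNIV level5 "1 / 20" "10 / 9" "- 21 / 50"])
  fix b
  show "level5 b holomorphic_on upper_half_plane"
  proof -
    have hE: "(\<lambda>z. eisenstein4 (f z)) holomorphic_on A"
      if "f holomorphic_on A" "\<And>z. z \<in> A \<Longrightarrow> Im (f z) > 0" for f A
      unfolding eisenstein4_def using that
      by (intro holomorphic_intros holomorphic_eta_sq) (auto simp: eta_sq_nonzero)
    have hq: "eta_quot5 holomorphic_on upper_half_plane"
      unfolding eta_quot5_def by (intro holomorphic_intros holomorphic_eta_sq) (auto simp: eta_sq_nonzero)
    show ?thesis
      unfolding level5_def
      by (cases b; simp; intro holomorphic_intros holomorphic_eta_sq hE hq)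
         (auto simp: eta_sq_nonzero eta_quot5_nonzero)
  qed
  show "norm (level5 b (\<tau> + 1)) = norm (level5 b \<tau>)" if "Im \<tau> > 0" for \<tau>
    by (simp add: level5_add_1[OF that])
  show "(level5 b \<longlongrightarrow> 0) cusp_filter"
    by (rule level5_tendsto_0)
next
  fix \<tau> :: complex
  assume \<tau>: "- 21 / 50 \<le> Re \<tau>" "Re \<tau> \<le> - 21 / 50 + 1" "0 < Im \<tau>" "Im \<tau> < 1 / 20"
  have y2: "(Im \<tau>)\<^sup>2 \<le> (1 / 20)\<^sup>2"
    using \<tau> by (intro power_mono) auto
  have raise: "10 / 9 * Im \<tau> \<le> Im \<tau> / d" if "d > 0" "d \<le> 9 / 10" for d
  proof -
    have "10 / 9 * Im \<tau> * d \<le> 10 / 9 * Im \<tau> * (9 / 10)"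
      using that \<tau>(3) by (intro mult_left_mono) auto
    then show ?thesis
      using that by (simp add: field_simps)
  qed
  show "\<exists>\<tau>'. 10 / 9 * Im \<tau> \<le> Im \<tau>' \<and> (\<forall>i\<in>UNIV. \<exists>j\<in>UNIV. norm (level5 i \<tau>) = norm (level5 j \<tau>'))"
  proof (cases "Re \<tau> \<le> 21 / 50")
    case True
    then have "(Re \<tau>)\<^sup>2 \<le> (21 / 50)\<^sup>2"
      using \<tau> by (intro power2_le_iff_abs_le[THEN iffD2]) auto
    then have "5 * (norm \<tau>)\<^sup>2 \<le> 9 / 10"
      using y2 unfolding cmod_power2 by (simp add: power2_eq_square)
    moreover have "5 * (norm \<tau>)\<^sup>2 > 0"
      using \<tau>(3) by auto
    moreover have "Im (- 1 / (5 * \<tau>)) = Im \<tau> / (5 * (norm \<tau>)\<^sup>2)"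
      unfolding Im_minus_inverse by (simp add: norm_mult power_mult_distrib)
    ultimately have "10 / 9 * Im \<tau> \<le> Im (- 1 / (5 * \<tau>))"
      using raise by simp
    moreover have "norm (level5 i \<tau>) = norm (level5 (\<not> i) (- 1 / (5 * \<tau>)))" for i
      unfolding level5_fricke[OF \<tau>(3)] by simp
    ultimately show ?thesis by blast
  next
    case False
    define \<gamma> where "\<gamma> = (2 * \<tau> - 1) / (5 * \<tau> - 2)"
    define d where "d = (norm (5 * \<tau> - 2))\<^sup>2"
    have u: "5 * \<tau> - 2 \<noteq> 0" using \<tau>(3) by (auto simp: complex_eq_iff)
    have "(5 * Re \<tau> - 2)\<^sup>2 \<le> (9 / 10)\<^sup>2"
      using \<tau> False by (intro power2_le_iff_abs_le[THEN iffD2]) auto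
    then have "d \<le> 9 / 10"
      using y2 unfolding d_def cmod_power2 by (simp add: power2_eq_square)
    moreover have "d > 0" using u by (simp add: d_def)
    moreover have "Im \<gamma> = Im \<tau> / d"
      unfolding \<gamma>_def d_def Im_divide cmod_power2 by (simp add: algebra_simps)
    ultimately have "10 / 9 * Im \<tau> \<le> Im \<gamma>"
      using raise by simp
    moreover have "norm (level5 i \<tau>) = norm (level5 i \<gamma>)" for i
      unfolding \<gamma>_def level5_elliptic_element[OF \<tau>(3)] by simp
    ultimately show ?thesis by blast
  qed
qed (use assms in auto)

section \<open>Translation to \<open>A_fun\<close> and \<open>j_fun\<close>, and the equation for
  \<open>X\<close>\<close>

lemma ramanujan_f_uminus:
  fixes x :: "'a :: {real_normed_field, banach}"
  shows "ramanujan_f (- x) = euler_phi x"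
  by (simp add: ramanujan_f_def euler_phi_def qpoch_def)

lemma dedekind_eta_squared: "dedekind_eta \<tau> ^ 2 = eta_sq \<tau>"
proof -
  have "exp (2 * of_real pi * \<i> * of_nat (Suc n) * \<tau>) = ee \<tau> ^ Suc n" for n
    unfolding ee_power by (simp only: ee_def mult_ac)
  moreover have "exp (of_real pi * \<i> * \<tau> / 12) ^ 2 = ee (\<tau> / 12)"
    by (simp add: ee_def exp_of_nat_mult[symmetric])
  ultimately show ?thesis
    by (simp add: dedekind_eta_def eta_sq_def euler_phi_def qpoch_def power_mult_distrib)
qed

text \<open>The bracket in \<open>j_fun\<close> is E_4 / eta^8, so this is the classical j = E_4^3 /
  eta^24.\<close>

lemma j_fun_eisenstein4:
  assumes "r > 0" "\<tau> = \<i> * of_real (sqrt r)"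
  shows "j_fun r = (eisenstein4 \<tau> / eta_sq \<tau> ^ 4) ^ 3"
proof -
  have "Im \<tau> > 0" using assms by simp
  then have nz: "eta_sq \<tau> \<noteq> 0" "eta_sq (\<tau> / 2) \<noteq> 0"
    by (simp_all add: eta_sq_nonzero)
  have eta: "dedekind_eta \<sigma> ^ 16 = eta_sq \<sigma> ^ 8" "dedekind_eta \<sigma> ^ 8 = eta_sq \<sigma> ^ 4" for \<sigma>
    by (simp_all flip: dedekind_eta_squared power_mult)
  have "j_fun r = ((dedekind_eta (\<tau> / 2) / dedekind_eta \<tau>) ^ 16 +
      16 * (dedekind_eta \<tau> / dedekind_eta (\<tau> / 2)) ^ 8) ^ 3"
    unfolding j_fun_def Let_def assms(2) by (rule refl)
  also have "(dedekind_eta (\<tau> / 2) / dedekind_eta \<tau>) ^ 16 + 16 * (dedekind_eta \<tau> / dedekind_eta (\<tau> / 2)) ^ 8 =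
      eisenstein4 \<tau> / eta_sq \<tau> ^ 4"
    unfolding power_divide eta eisenstein4_def using nz by (simp add: field_simps flip: power_add)
  finally show ?thesis .
qed

lemma A_fun_altdef:
  assumes "r > 0"
  shows "A_fun r = ramanujan_f (- exp (- (2 * pi * sqrt r))) ^ 6 /
    (exp (- (2 * pi * sqrt r)) * ramanujan_f (- exp (- (10 * pi * sqrt r))) ^ 6)"
  unfolding A_fun_def Let_def by (simp add: exp_of_nat_mult[symmetric] mult_ac)

lemma A_fun_eta_quot5:
  assumes "r > 0" "\<tau> = \<i> * of_real (sqrt r)"
  shows "eta_quot5 \<tau> = of_real (A_fun r)"
proof -
  define x y where "x = exp (- (2 * pi * sqrt r))" and "y = exp (- (10 * pi * sqrt r))"
  have xy: "\<bar>x\<bar> < 1" "\<bar>y\<bar> < 1" using assms(1) by (simp_all add: x_def y_def)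
  have ee: "ee \<tau> = of_real x" "ee (5 * \<tau>) = of_real y"
    by (simp_all add: ee_def assms(2) x_def y_def mult_ac flip: exp_of_real)
  \<comment> \<open>The exponential prefactors of the eta quotient supply the factor
    \<open>1 / q ^ 2\<close> of \<open>A_fun\<close>, whose \<open>q\<close> is the square root of
    \<open>x\<close>.\<close>
  have "(ee (\<tau> / 12) / ee (5 * \<tau> / 12)) ^ 3 = 1 / of_real x"
    unfolding ee(1)[symmetric] ee_diff[symmetric] ee_power ee_minus[symmetric]
    by (rule arg_cong[of _ _ ee]) simp
  moreover have "eta_quot5 \<tau> = (ee (\<tau> / 12) / ee (5 * \<tau> / 12)) ^ 3 *
      (euler_phi (of_real x) ^ 6 / euler_phi (of_real y) ^ 6)"
    unfolding eta_quot5_def eta_sq_def ee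
    by (simp add: power_mult_distrib power_divide flip: power_mult)
  ultimately have "eta_quot5 \<tau> = (1 / of_real x) * (euler_phi (of_real x) ^ 6 / euler_phi (of_real y) ^ 6)"
    by simp
  also have "\<dots> = of_real (A_fun r)"
    unfolding A_fun_altdef[OF assms(1)] ramanujan_f_uminus x_def[symmetric] y_def[symmetric]
      euler_phi_of_real[OF xy(1)] euler_phi_of_real[OF xy(2)]
    by simp
  finally show ?thesis .
qed

text \<open>The level 5 identity gives E_4 / eta^8 up to the factor (eta(5 tau) / eta(tau))^4, a
  power t^(-2/3) of the Hauptmodul; cubing makes the exponent integral.\<close>

lemma j_fun_A_fun:
  assumes "r > 0"
  shows "A_fun r \<noteq> 0"
    and "j_fun r = of_real ((A_fun r + 250 + 3125 / A_fun r) ^ 3 / A_fun r ^ 2)"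
proof -
  define \<tau> where "\<tau> = \<i> * of_real (sqrt r)"
  define t where "t = eta_quot5 \<tau>"
  have im: "Im \<tau> > 0" "Im (5 * \<tau>) > 0" using assms by (simp_all add: \<tau>_def)
  note nz = eta_sq_nonzero[OF im(1)] eta_sq_nonzero[OF im(2)]
  have t: "t = of_real (A_fun r)"
    unfolding t_def by (rule A_fun_eta_quot5[OF assms \<tau>_def])
  have "t \<noteq> 0" unfolding t_def by (rule eta_quot5_nonzero[OF im(1)])
  then show "A_fun r \<noteq> 0" by (simp add: t)
  have "eisenstein4 \<tau> / (eta_sq \<tau> * eta_sq (5 * \<tau>)) ^ 2 = t + 250 + 3125 / t"
    using level5_eq_0[OF im(1), of True] by (simp add: level5_def t_def)
  then have "eisenstein4 \<tau> / eta_sq \<tau> ^ 4 = (t + 250 + 3125 / t) * (eta_sq (5 * \<tau>) / eta_sq \<tau>) ^ 2"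
    using nz by (simp add: field_simps power2_eq_square power4_eq_xxxx)
  then have "j_fun r = (t + 250 + 3125 / t) ^ 3 * ((eta_sq (5 * \<tau>) / eta_sq \<tau>) ^ 2) ^ 3"
    unfolding j_fun_eisenstein4[OF assms \<tau>_def] by (simp only: power_mult_distrib)
  also have "((eta_sq (5 * \<tau>) / eta_sq \<tau>) ^ 2) ^ 3 = 1 / t ^ 2"
    unfolding t_def eta_quot5_def by (simp add: power_divide flip: power_mult)
  finally show "j_fun r = of_real ((A_fun r + 250 + 3125 / A_fun r) ^ 3 / A_fun r ^ 2)"
    by (simp add: t)
qed

theorem theorem1:
  fixes a b C\<^sub>1 r X :: real
  assumes "a \<noteq> 0" and "b \<noteq> 0" and "r > 0"
    and "j_fun r = complex_of_real (250 * C\<^sub>1 ^ 3 / (a ^ 2 * b))"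
    and "X = b / (250 * a) * A_fun r"
  shows "X = b / (250 * a) *
           (ramanujan_f (- exp (- (2 * pi * sqrt r))) ^ 6 /
            (exp (- (2 * pi * sqrt r)) * ramanujan_f (- exp (- (10 * pi * sqrt r))) ^ 6))
       \<and> b ^ 2 / (20 * a) + b * X + a * X ^ 2 = C\<^sub>1 * root 3 X ^ 5"
proof
  show "X = b / (250 * a) * (ramanujan_f (- exp (- (2 * pi * sqrt r))) ^ 6 /
      (exp (- (2 * pi * sqrt r)) * ramanujan_f (- exp (- (10 * pi * sqrt r))) ^ 6))"
    unfolding assms(5) A_fun_altdef[OF assms(3)] by (rule refl)
  define t where "t = A_fun r"
  define s where "s = t + 250 + 3125 / t"
  define L where "L = b ^ 2 / (20 * a) + b * X + a * X ^ 2"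
  have t0: "t \<noteq> 0" unfolding t_def by (rule j_fun_A_fun(1)[OF assms(3)])
  have "complex_of_real (250 * C\<^sub>1 ^ 3 / (a ^ 2 * b)) = of_real (s ^ 3 / t ^ 2)"
    using assms(4) j_fun_A_fun(2)[OF assms(3)] unfolding s_def t_def by simp
  then have "250 * C\<^sub>1 ^ 3 / (a ^ 2 * b) = s ^ 3 / t ^ 2"
    unfolding of_real_eq_iff .
  then have s3: "s ^ 3 = 250 * C\<^sub>1 ^ 3 * t ^ 2 / (a ^ 2 * b)"
    using t0 by (simp add: field_simps)
  have X: "X = b * t / (250 * a)"
    by (simp add: assms(5) t_def)
  \<comment> \<open>As 62500 = 250^2 and 62500 / 20 = 3125, the polynomial in \<open>X\<close> is a
    multiple of \<open>s\<close>.\<close>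
  have L: "L = b ^ 2 * t / (62500 * a) * s"
    unfolding L_def X s_def using assms(1) t0 by (simp add: field_simps power2_eq_square)
  \<comment> \<open>Cubing brings in the hypothesis on \<open>j_fun\<close>; the constants match
    because 250 / 62500^3 = 250^(-5).\<close>
  have "L ^ 3 = C\<^sub>1 ^ 3 * X ^ 5"
    unfolding L power_mult_distrib s3 X using assms(1,2)
    by (simp add: field_simps power_mult_distrib power_divide) (simp add: eval_nat_numeral)
  also have "X ^ 5 = (root 3 X ^ 5) ^ 3"
    using odd_real_root_pow[of 3 X] power_mult[of "root 3 X" 3 5] power_mult[of "root 3 X" 5 3] by simp
  also have "C\<^sub>1 ^ 3 * \<dots> = (C\<^sub>1 * root 3 X ^ 5) ^ 3"
    by (simp only: power_mult_distrib)
  finally have "root 3 (L ^ 3) = root 3 ((C\<^sub>1 * root 3 X ^ 5) ^ 3)"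
    by (rule arg_cong)
  then show "b ^ 2 / (20 * a) + b * X + a * X ^ 2 = C\<^sub>1 * root 3 X ^ 5"
    by (simp add: odd_real_root_power_cancel L_def)
qed

end
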